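(* Let $\Omega\subset\mathbb{R}^n$ be a bounded open set containing the origin. Let $p(\cdot),q(\cdot)\in\mathcal{P}(\Omega)$ be such that $p(\cdot),q(\cdot)\in LH_0(\Omega)$, $1<p_-\le p_+<\infty$, $1<q_-\le q_+<\infty$, and $p(x)\le q(x)$ for all $x\in\Omega$. Let $\lambda(\cdot):\Omega\to[0,n]$ be such that $0<\lambda_-\le\lambda_+<n$ and $\lambda(\cdot)\in LH_0(\Omega)$. Let $a,b$ be real constants such that \[ 0\le b-a\le 1,\qquad \frac{\lambda_+-n}{q_+}<a\le b<\frac{n}{(p')_+}, \] and such that for all $x\in\Omega$, \[ 0<\lambda_-\le\lambda(x)<n-(1-b+a)\,p(x),\qquad \frac{1+a-b}{n-\lambda(x)}=\frac1{p(x)}-\frac1{q(x)}. \] Then there exists a constant $C>0$ such that for all $f\in C_c^1(\Omega)$, \[ \big\||\cdot|^{a} f\big\|_{M^{\lambda(\cdot)}_{q(\cdot)}(\Omega)}\le C\,\big\||\cdot|^{b}\,\nabla f\big\|_{M^{\lambda(\cdot)}_{p(\cdot)}(\Omega)}. \]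
   Context: $\mathcal{P}(\Omega)$ is the set of measurable functions $p(\cdot):\Omega\to[1,\infty]$ (variable exponents). For a function $u(\cdot)$ on $\Omega$, $u_-=\operatorname{ess\,inf}_{x\in\Omega}u(x)$ and $u_+=\operatorname{ess\,sup}_{x\in\Omega}u(x)$. The conjugate exponent $p'(\cdot)$ is defined by $\frac1{p(x)}+\frac1{p'(x)}=1$, and $(p')_+$ is its essential supremum. A function $u:\Omega\to\mathbb{R}$ is in $LH_0(\Omega)$ (locally log-Hölder continuous) if there is a constant $C_0$ with $|u(x)-u(y)|\le \frac{C_0}{-\log|x-y|}$ for all $x,y\in\Omega$ with $|x-y|<\frac12$. Let $\tilde B(x,r)=\{y\in\Omega:|x-y|<r\}$. For $p(\cdot)\in\mathcal{P}(\Omega)$ and measurable $\lambda(\cdot):\Omega\to[0,n]$, define the modular \[ I_{p(\cdot),\lambda(\cdot)}(f)=\sup_{x\in\Omega,\,r>0} r^{-\lambda(x)}\int_{\tilde B(x,r)}|f(y)|^{p(y)}\,dy, \] and the variable exponent Morrey norm $\|f\|_{M^{\lambda(\cdot)}_{p(\cdot)}(\Omega)}=\inf\{\eta>0: I_{p(\cdot),\lambda(\cdot)}(f/\eta)\le1\}$ for measurable $f$ on $\Omega$ (with value $+\infty$ if the set is empty). For the vector-valued function $\nabla f$, the norm is that of $|\nabla f|$. $C_c^1(\Omega)$ is the space of $C^1$ functions with compact support in $\Omega$. *)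

theory Defs
  imports "HOL-Analysis.Analysis" "HOL-Probability.Essential_Supremum"
begin

text \<open>
  Functions on \<open>\<Omega>\<close> are total functions on the ambient Euclidean space of which only the values
  on \<open>\<Omega>\<close> matter. Measurability and measure are in the sense of Lebesgue.
\<close>

definition ess_sup_on :: "'a::euclidean_space set \<Rightarrow> ('a \<Rightarrow> ereal) \<Rightarrow> ereal" where
  "ess_sup_on \<Omega> u = esssup (lebesgue_on \<Omega>) u"

definition ess_inf_on :: "'a::euclidean_space set \<Rightarrow> ('a \<Rightarrow> ereal) \<Rightarrow> ereal" where
  "ess_inf_on \<Omega> u = - esssup (lebesgue_on \<Omega>) (\<lambda>x. - u x)"

definition variable_exponents :: "'a::euclidean_space set \<Rightarrow> ('a \<Rightarrow> ereal) set" where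
  "variable_exponents \<Omega> = {p. p \<in> borel_measurable (lebesgue_on \<Omega>) \<and> (\<forall>x\<in>\<Omega>. 1 \<le> p x)}"

text \<open>
  The solution of \<open>1/p(x) + 1/p'(x) = 1\<close>. In \<^typ>\<open>ereal\<close> we have \<open>1/0 = \<infinity>\<close> and \<open>1/\<infinity> = 0\<close>,
  so this is also right for \<open>p(x) = 1\<close> and \<open>p(x) = \<infinity>\<close>.
\<close>
definition conjugate_exponent :: "('a \<Rightarrow> ereal) \<Rightarrow> 'a \<Rightarrow> ereal" where
  "conjugate_exponent p x = 1 / (1 - 1 / p x)"

text \<open>For \<open>x = y\<close> the inequality reads \<open>0 \<le> 0\<close>, because \<open>ln 0 = 0\<close> and \<open>C / 0 = 0\<close> in HOL.\<close>
definition LH0 :: "'a::euclidean_space set \<Rightarrow> ('a \<Rightarrow> real) set" where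
  "LH0 \<Omega> = {u. \<exists>C. \<forall>x\<in>\<Omega>. \<forall>y\<in>\<Omega>. dist x y < 1/2 \<longrightarrow> \<bar>u x - u y\<bar> \<le> C / (- ln (dist x y))}"

text \<open>
  The modular and the norm take values in \<open>[0, \<infinity>]\<close>. The exponent is real-valued here, so that
  \<open>|f(y)|\<^bsup>p(y)\<^esup>\<close> needs no convention for \<open>p(y) = \<infinity>\<close>.
\<close>
definition morrey_modular ::
  "'a::euclidean_space set \<Rightarrow> ('a \<Rightarrow> real) \<Rightarrow> ('a \<Rightarrow> real) \<Rightarrow> ('a \<Rightarrow> 'b::real_normed_vector) \<Rightarrow> ennreal"
where
  "morrey_modular \<Omega> p lam f =
    (SUP x\<in>\<Omega>. SUP r\<in>{0<..}.
       ennreal (r powr (- lam x)) *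
       (\<integral>\<^sup>+ y \<in> {y\<in>\<Omega>. dist x y < r}. ennreal (norm (f y) powr p y) \<partial>lebesgue))"

text \<open>The infimum of the empty set in \<^typ>\<open>ennreal\<close> is \<open>\<infinity>\<close>.\<close>
definition morrey_norm ::
  "'a::euclidean_space set \<Rightarrow> ('a \<Rightarrow> real) \<Rightarrow> ('a \<Rightarrow> real) \<Rightarrow> ('a \<Rightarrow> 'b::real_normed_vector) \<Rightarrow> ennreal"
where
  "morrey_norm \<Omega> p lam f =
    Inf {ennreal \<eta> | \<eta>. 0 < \<eta> \<and> morrey_modular \<Omega> p lam (\<lambda>x. f x /\<^sub>R \<eta>) \<le> 1}"

definition gradient :: "('a::euclidean_space \<Rightarrow> real) \<Rightarrow> 'a \<Rightarrow> 'a" where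
  "gradient f x = (THE D. GDERIV f x :> D)"

definition C1_compact_support :: "'a::euclidean_space set \<Rightarrow> ('a \<Rightarrow> real) set" where
  "C1_compact_support \<Omega> =
    {f. (\<forall>x\<in>\<Omega>. f differentiable (at x)) \<and> continuous_on \<Omega> (gradient f) \<and>
        compact (closure {x\<in>\<Omega>. f x \<noteq> 0}) \<and> closure {x\<in>\<Omega>. f x \<noteq> 0} \<subseteq> \<Omega>}"

end

theory Submission
  imports Defs
begin

text \<open>
  Write \<open>n\<close> for the dimension, \<open>\<mu>(x) = n - \<lambda>(x)\<close>, \<open>\<alpha> = 1 + a - b\<close> and \<open>G = |x|\<^sup>b |\<nabla>f|\<close>, normalised to have
  modular at most \<open>1\<close>. Averaging the fundamental theorem of calculus over rays bounds \<open>|f(x)|\<close> by the integral of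
  \<open>s \<mapsto> s\<^bsup>-n\<^esup> \<integral>\<^bsub>B(x,s)\<^esub> |y|\<^bsup>-b\<^esup> G(y) dy\<close> over \<open>0 < s < 2R\<close>. For \<open>s \<ge> |x|/2\<close> the balls are enlarged to
  balls around \<open>0\<close>, where the Morrey bound and the conditions on \<open>a\<close> and \<open>b\<close> give a multiple of
  \<open>|x|\<^bsup>-a-\<mu>(0)/q(0)\<^esup>\<close>, whose contribution has finite Morrey modular by direct computation. For \<open>s < |x|/2\<close> the
  weights are constant up to a factor, and Hedberg's interpolation between the averages of \<open>G\<close> and the
  Morrey bound \<open>s\<^bsup>-\<mu>(x)/p(x)\<^esup>\<close> gives \<open>(M G)\<^bsup>p(x)/q(x)\<^esup>\<close>; the factor \<open>|x|\<^bsup>\<alpha>-1\<^esup>\<close> makes this work for all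
  \<open>0 \<le> \<alpha> \<le> 1\<close>. Diening's pointwise estimate then reduces the maximal function in the variable exponent
  space to the Hardy--Littlewood theorem in \<open>L\<^bsup>\<sigma>\<^esup>\<close> with the constant \<open>\<sigma> = p\<^sub>-\<close>; mass far from the centre is again
  controlled by the Morrey bound.
\<close>

subsection \<open>Integrals of powers\<close>

text \<open>The obstacle is the lack of homogeneity of the modular when the exponent varies: the
  usual scaling proofs of Hoelder's and Jensen's inequalities are not at hand. Both are replaced by
  \<open>g \<le> t + g powr e * t powr (1 - e)\<close> with a free level \<open>t\<close>, set to a
  power of the radius for the Morrey bound and to a power of the average for Diening's estimate.
  Exchanging \<open>p y\<close> for \<open>p x\<close> in the power of \<open>t\<close> costs a
  bounded factor, since log-Hoelder continuity bounds \<open>r powr (u x - u y)\<close> while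
  \<open>dist x y \<le> 2 * r\<close>. The hypotheses are scaling identities. With
  \<open>e = \<mu> x / p x\<close>, the relation between the exponents says
  \<open>e - \<alpha> = \<mu> x / q x\<close>, so Hedberg's exponent
  \<open>(e - \<alpha>) / e\<close> is \<open>p x / q x\<close>. At the origin it reads
  \<open>b + \<mu> 0 / p 0 = 1 + a + \<mu> 0 / q 0\<close>; the bounds on \<open>a\<close> and
  \<open>b\<close> place this number strictly between 1, for convergence at large radii, and
  \<open>n\<close>, for integrability of the weighted function at 0. The choice of \<sigma> serves
  twice: \<open>p / \<sigma> \<ge> 1\<close> allows Diening's estimate, and
  \<open>\<sigma> > 1\<close> the maximal theorem.\<close>

lemma le_add_powr_mult_powr:
  fixes g t e :: real
  assumes "0 \<le> g" "0 < t" "1 \<le> e"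
  shows "g \<le> t + g powr e * t powr (1 - e)"
proof (cases "g \<le> t")
  case True
  then show ?thesis using assms by (simp add: add_increasing2)
next
  case False
  then have "g powr (1 - e) \<le> t powr (1 - e)"
    using assms by (intro powr_mono2') auto
  then have "g powr e * g powr (1 - e) \<le> g powr e * t powr (1 - e)"
    by (intro mult_left_mono) auto
  moreover have "g powr e * g powr (1 - e) = g"
    using False assms by (simp flip: powr_add)
  ultimately show ?thesis using assms by linarith
qed

lemma nn_integral_powr_atLeast:
  fixes c k :: real
  assumes "0 < c" "1 < k"
  shows "(\<integral>\<^sup>+s\<in>{c..}. ennreal (s powr (-k)) \<partial>lborel) = ennreal (c powr (1 - k) / (k - 1))"
proof -
  have "(\<integral>\<^sup>+s. ennreal (s powr (-k)) * indicator {c..} s \<partial>lborel)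
      = ennreal (0 - (- (c powr (1 - k)) / (k - 1)))"
  proof (rule nn_integral_FTC_atLeast[where F="\<lambda>s. - (s powr (1 - k)) / (k - 1)"])
    show "((\<lambda>s. - (s powr (1 - k)) / (k - 1)) has_real_derivative x powr - k) (at x)"
      if "c \<le> x" for x
    proof -
      have "((\<lambda>s. - (s powr (1 - k)) / (k - 1)) has_real_derivative - ((1 - k) * x powr (1 - k - 1)) / (k - 1)) (at x)"
        using that assms by (intro DERIV_cdivide DERIV_minus has_real_derivative_powr) auto
 
      moreover have "- ((1 - k) * x powr (1 - k - 1)) / (k - 1) = x powr - k"
        using assms by (simp add: divide_eq_eq algebra_simps)
      ultimately show ?thesis by simp
    qed
    have "((\<lambda>s::real. s powr (1 - k)) \<longlongrightarrow> 0) at_top"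
      using assms by (intro tendsto_neg_powr filterlim_ident) auto
    then show "((\<lambda>s. - (s powr (1 - k)) / (k - 1)) \<longlongrightarrow> 0) at_top"
      using tendsto_divide[OF tendsto_minus tendsto_const, of _ 0 at_top "k - 1"] assms by force
  qed auto
  then show ?thesis by simp
qed

text \<open>Dyadic decomposition: where \<open>norm y\<close> lies between
  \<open>r / 2 ^ (j + 1)\<close> and \<open>r / 2 ^ j\<close>, the weight is comparable to the same
  power of the radius, up to \<open>2 powr \<bar>\<beta>\<bar>\<close> for either sign of \<beta>.
  The growth bound on balls then yields a geometric series of ratio
  \<open>2 powr (\<beta> - e)\<close>, which is below 1 because \<open>\<beta> < e\<close>.\<close>

lemma nn_integral_norm_powr_ball:
  fixes g :: "'a::euclidean_space \<Rightarrow> ennreal"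
  assumes gm: "g \<in> borel_measurable borel"
    and "0 < r" "0 \<le> A" "\<beta> < e"
    and le: "\<And>s. 0 < s \<Longrightarrow> s \<le> r \<Longrightarrow> (\<integral>\<^sup>+y\<in>ball 0 s. g y \<partial>lborel) \<le> ennreal (A * s powr e)"
  shows "(\<integral>\<^sup>+y\<in>ball 0 r. ennreal (norm y powr (-\<beta>)) * g y \<partial>lborel)
      \<le> ennreal (2 powr \<bar>\<beta>\<bar> / (1 - 2 powr (\<beta> - e)) * A * r powr (e - \<beta>))"
proof -
  define s where "s k = r / 2 ^ k" for k :: nat
  have s_pos: "0 < s k" for k using assms by (simp add: s_def)
  have s_le: "s k \<le> r" for k using assms by (simp add: s_def divide_le_eq)
  have s_lim: "s \<longlonglongrightarrow> 0"
    unfolding s_def by (rule LIMSEQ_divide_realpow_zero) simp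
  \<comment> \<open>Each term carries the whole ball of radius \<open>s k\<close> instead of an
    annulus, so that the hypothesis on balls applies to it directly.\<close>
  define h where "h k y = ennreal (2 powr \<bar>\<beta>\<bar> * s k powr (-\<beta>)) * (g y * indicator (ball 0 (s k)) y)" for k y
  have hm: "h k \<in> borel_measurable borel" for k
    unfolding h_def using assms(1) by (intro borel_measurable_times_ennreal borel_measurable_const borel_measurable_indicator) auto
  have pt: "ennreal (norm y powr (-\<beta>)) * g y * indicator (ball 0 r) y \<le> (\<Sum>k. h k y)"
    if "y \<noteq> 0" for y
  proof (cases "norm y < r")
    case True
    have "eventually (\<lambda>k. s k < norm y) sequentially"
      using s_lim that by (intro order_tendstoD) auto
    then obtain k0 where k0: "s k0 < norm y"
      using eventually_happens'[OF sequentially_bot] by blast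
    define k where "k = (LEAST k. s k \<le> norm y)"
    have k1: "s k \<le> norm y" unfolding k_def by (rule LeastI[of "\<lambda>k. s k \<le> norm y" k0]) (rule less_imp_le[OF k0])
    have "k \<noteq> 0"
    proof
      assume "k = 0"
      with k1 True show False by (simp add: s_def)
    qed
    then obtain j where j: "k = Suc j" by (cases k) auto
    then have k2: "norm y < s j" using not_less_Least[of j "\<lambda>k. s k \<le> norm y"] unfolding k_def[symmetric] by simp
    have k3: "s j \<le> 2 * norm y" using k1 j by (simp add: s_def)
    have "norm y powr (-\<beta>) \<le> 2 powr \<bar>\<beta>\<bar> * s j powr (-\<beta>)"
    proof (cases "\<beta> \<ge> 0")
      case True
      have "(norm y * 2) powr (-\<beta>) \<le> s j powr (-\<beta>)"
        using k3 s_pos True by (intro powr_mono2') (auto simp: mult.commute)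
      then have "2 powr \<beta> * (norm y powr (-\<beta>) * 2 powr (-\<beta>)) \<le> 2 powr \<beta> * s j powr (-\<beta>)"
        using True by (intro mult_left_mono) (auto simp: powr_mult)
      then show ?thesis using True by (simp add: powr_minus divide_simps mult.commute)
    next
      case False
      have "1 * norm y powr (-\<beta>) \<le> 2 powr \<bar>\<beta>\<bar> * s j powr (-\<beta>)"
        using k2 False by (intro mult_mono powr_mono2 ge_one_powr_ge_zero) auto
      then show ?thesis by simp
    qed
    then have "ennreal (norm y powr (-\<beta>)) * g y * indicator (ball 0 r) y \<le> h j y"
      using k2 True unfolding h_def by (auto intro!: mult_right_mono ennreal_leI simp: mult.assoc[symmetric])
    also have "\<dots> = (\<Sum>k\<in>{j}. h k y)" by simp
    also have "\<dots> \<le> (\<Sum>k. h k y)" by (intro sum_le_suminf) auto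
    finally show ?thesis .
  qed auto
  have "(\<integral>\<^sup>+y\<in>ball 0 r. ennreal (norm y powr (-\<beta>)) * g y \<partial>lborel)
      \<le> (\<integral>\<^sup>+y. (\<Sum>k. h k y) \<partial>lborel)"
  proof (rule nn_integral_mono_AE)
    show "AE y in lborel. ennreal (norm y powr (-\<beta>)) * g y * indicator (ball 0 r) y \<le> (\<Sum>k. h k y)"
      using AE_lborel_singleton[of "0::'a"] by eventually_elim (rule pt)
  qed
  also have "\<dots> = (\<Sum>k. \<integral>\<^sup>+y. h k y \<partial>lborel)"
    by (rule nn_integral_suminf) (simp add: hm)
  also have "\<dots> \<le> (\<Sum>k. ennreal (2 powr \<bar>\<beta>\<bar> * A * r powr (e - \<beta>) * (2 powr (\<beta> - e)) ^ k))"
  proof (rule suminf_le)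
    fix k
    have "(\<integral>\<^sup>+y. h k y \<partial>lborel) = ennreal (2 powr \<bar>\<beta>\<bar> * s k powr (-\<beta>)) * (\<integral>\<^sup>+y\<in>ball 0 (s k). g y \<partial>lborel)"
      unfolding h_def using gm by (intro nn_integral_cmult borel_measurable_times_ennreal borel_measurable_indicator) auto
    also have "\<dots> \<le> ennreal (2 powr \<bar>\<beta>\<bar> * s k powr (-\<beta>)) * ennreal (A * s k powr e)"
      by (intro mult_left_mono le s_pos s_le) auto
    also have "\<dots> = ennreal (2 powr \<bar>\<beta>\<bar> * A * s k powr (e - \<beta>))"
      using assms by (simp add: ennreal_mult[symmetric] powr_diff powr_minus field_simps)
    also have "s k powr (e - \<beta>) = r powr (e - \<beta>) * (2 powr (\<beta> - e)) ^ k"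
    proof -
      have "s k = r * 2 powr (- real k)" using assms by (simp add: s_def powr_minus powr_realpow field_simps)
      then have "s k powr (e - \<beta>) = r powr (e - \<beta>) * (2 powr (- real k)) powr (e - \<beta>)"
        using assms by (simp add: powr_mult)
      also have "(2 powr (- real k)) powr (e - \<beta>) = (2 powr (\<beta> - e)) powr (real k)"
        by (simp add: powr_powr algebra_simps)
      finally show ?thesis by (simp add: powr_realpow)
    qed
    finally show "(\<integral>\<^sup>+y. h k y \<partial>lborel) \<le> ennreal (2 powr \<bar>\<beta>\<bar> * A * r powr (e - \<beta>) * (2 powr (\<beta> - e)) ^ k)"
      by (simp add: mult.assoc)
  qed auto
  also have "\<dots> = ennreal (2 powr \<bar>\<beta>\<bar> * A * r powr (e - \<beta>) * (1 / (1 - 2 powr (\<beta> - e))))"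
  proof (rule suminf_ennreal_eq)
    have "(2::real) powr (\<beta> - e) < 2 powr 0" using assms by (intro powr_less_mono) auto
    then show "(\<lambda>k. 2 powr \<bar>\<beta>\<bar> * A * r powr (e - \<beta>) * (2 powr (\<beta> - e)) ^ k) sums
        (2 powr \<bar>\<beta>\<bar> * A * r powr (e - \<beta>) * (1 / (1 - 2 powr (\<beta> - e))))"
      by (intro sums_mult geometric_sums) simp
  qed (use assms in auto)
  finally show ?thesis by (simp add: field_simps)
qed

text \<open>The pointwise interpolation behind Hedberg's inequality, split at \<open>s = T\<^bsup>-1/e\<^esup>\<close>.\<close>
lemma nn_integral_min_powr_le:
  fixes T e \<alpha> \<rho> :: real
  assumes "0 < T" "0 \<le> \<alpha>" "\<alpha> \<le> 1" "\<alpha> < e" "0 < \<rho>"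
  shows "(\<integral>\<^sup>+s\<in>{0<..<\<rho>}. ennreal (\<rho> powr (\<alpha> - 1) * min T (s powr (-e))) \<partial>lborel)
     \<le> ennreal ((1 + 1 / (e - \<alpha>)) * T powr ((e - \<alpha>) / e))"
proof -
  define d where "d = T powr (- 1 / e)"
  have d: "0 < d" using assms by (simp add: d_def)
  have "(\<integral>\<^sup>+s\<in>{0<..<\<rho>}. ennreal (\<rho> powr (\<alpha> - 1) * min T (s powr (-e))) \<partial>lborel)
    \<le> (\<integral>\<^sup>+s. ennreal (\<rho> powr (\<alpha> - 1) * T) * indicator {0<..<min d \<rho>} s
        + ennreal (s powr (- (1 + e - \<alpha>))) * indicator {d..} s \<partial>lborel)"
  proof (rule nn_integral_mono)
    fix s :: real
    \<comment> \<open>Since \<open>\<alpha> \<le> 1\<close> and \<open>s < \<rho>\<close>, the first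
      factor is at most \<open>s powr (\<alpha> - 1)\<close>; the resulting power of
      \<open>s\<close> is integrable at infinity because \<open>\<alpha> < e\<close>.\<close>
    have "\<rho> powr (\<alpha> - 1) * min T (s powr (-e)) \<le> s powr (- (1 + e - \<alpha>))" if "0 < s" "s < \<rho>"
    proof -
      have "\<rho> powr (\<alpha> - 1) * min T (s powr (-e)) \<le> s powr (\<alpha> - 1) * s powr (-e)"
        using that assms by (intro mult_mono powr_mono2') auto
      also have "\<dots> = s powr (- (1 + e - \<alpha>))" by (simp add: algebra_simps flip: powr_add)
      finally show ?thesis .
    qed
    moreover have "\<rho> powr (\<alpha> - 1) * min T (s powr (-e)) \<le> \<rho> powr (\<alpha> - 1) * T"
      by (intro mult_left_mono) auto
    ultimately show "ennreal (\<rho> powr (\<alpha> - 1) * min T (s powr (-e))) * indicator {0<..<\<rho>} s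
      \<le> ennreal (\<rho> powr (\<alpha> - 1) * T) * indicator {0<..<min d \<rho>} s
        + ennreal (s powr (- (1 + e - \<alpha>))) * indicator {d..} s"
      by (auto simp: indicator_def intro!: ennreal_leI)
  qed
  also have "\<dots> = ennreal (\<rho> powr (\<alpha> - 1) * T) * ennreal (min d \<rho>)
      + ennreal (d powr (1 - (1 + e - \<alpha>)) / (1 + e - \<alpha> - 1))"
  proof (subst nn_integral_add)
    have "(\<integral>\<^sup>+s\<in>{d..}. ennreal (s powr (- (1 + e - \<alpha>))) \<partial>lborel)
        = ennreal (d powr (1 - (1 + e - \<alpha>)) / (1 + e - \<alpha> - 1))"
      using assms d by (intro nn_integral_powr_atLeast) auto
    then show "(\<integral>\<^sup>+s\<in>{0<..<min d \<rho>}. ennreal (\<rho> powr (\<alpha> - 1) * T) \<partial>lborel)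
        + (\<integral>\<^sup>+s\<in>{d..}. ennreal (s powr (- (1 + e - \<alpha>))) \<partial>lborel)
      = ennreal (\<rho> powr (\<alpha> - 1) * T) * ennreal (min d \<rho>)
        + ennreal (d powr (1 - (1 + e - \<alpha>)) / (1 + e - \<alpha> - 1))"
      using assms d by (simp add: nn_integral_cmult_indicator del: minus_add_distrib minus_diff_eq)
  qed auto
  also have "\<dots> = ennreal (\<rho> powr (\<alpha> - 1) * T * min d \<rho> + d powr (\<alpha> - e) / (e - \<alpha>))"
    using assms d by (simp add: ennreal_mult[symmetric] ennreal_plus[symmetric] del: ennreal_plus)
  also have "\<dots> \<le> ennreal ((1 + 1 / (e - \<alpha>)) * T powr ((e - \<alpha>) / e))"
  proof (rule ennreal_leI)
    \<comment> \<open>Geometric splitting of the minimum: the factor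
      \<open>\<rho> powr (1 - \<alpha>)\<close> cancels \<open>\<rho> powr (\<alpha> - 1)\<close>,
      so the bound is independent of \<rho>. Both exponents are nonnegative because
      \<open>0 \<le> \<alpha> \<le> 1\<close>.\<close>
    have "min d \<rho> = min d \<rho> powr \<alpha> * min d \<rho> powr (1 - \<alpha>)"
      using assms d by (subst powr_add[symmetric]) (auto simp: min_def)
    also have "\<dots> \<le> d powr \<alpha> * \<rho> powr (1 - \<alpha>)"
      using assms d by (intro mult_mono powr_mono2) auto
    finally have "\<rho> powr (\<alpha> - 1) * T * min d \<rho> \<le> \<rho> powr (\<alpha> - 1) * T * (d powr \<alpha> * \<rho> powr (1 - \<alpha>))"
      using assms by (intro mult_left_mono) auto
    also have "\<dots> = T powr 1 * d powr \<alpha>" using assms by (simp add: powr_diff)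
    also have "\<dots> = T powr ((e - \<alpha>) / e)"
      using assms unfolding d_def powr_powr powr_add[symmetric] by (simp add: field_simps)
    finally have 1: "\<rho> powr (\<alpha> - 1) * T * min d \<rho> \<le> T powr ((e - \<alpha>) / e)" .
    have "d powr (\<alpha> - e) = T powr ((e - \<alpha>) / e)"
      using assms unfolding d_def powr_powr by (simp add: field_simps) (simp add: minus_divide_left)
    with 1 show "\<rho> powr (\<alpha> - 1) * T * min d \<rho> + d powr (\<alpha> - e) / (e - \<alpha>)
       \<le> (1 + 1 / (e - \<alpha>)) * T powr ((e - \<alpha>) / e)"
      by (simp add: algebra_simps)
  qed
  finally show ?thesis .
qed

subsection \<open>The maximal theorem and the representation by averages\<close>

text \<open>Weak type bound with truncation. The values of \<open>h\<close> up to
  \<open>t / (2 * V)\<close> contribute at most \<open>t * r ^ n / 2\<close> to a ball of radius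
  \<open>r\<close>, so the larger values carry at least the other half. Vitali's lemma selects
  disjoint balls whose fivefold enlargements cover \<open>S\<close>; the constant is the quotient of
  \<open>V * (5 * r) ^ n\<close> by \<open>t * r ^ n / 2\<close>. Averages are normalised by
  \<open>r ^ n\<close> and not by the volume, hence \<open>V\<close> in the threshold.\<close>

lemma emeasure_maximal_superlevel:
  fixes h :: "'a::euclidean_space \<Rightarrow> real"
  assumes h: "h \<in> borel_measurable borel" "\<And>x. 0 \<le> h x"
    and S: "S \<in> sets borel" and "0 < t"
    and avg: "\<And>x. x \<in> S \<Longrightarrow> \<exists>r>0. r \<le> B \<and> ennreal (t * r ^ DIM('a)) < (\<integral>\<^sup>+y\<in>ball x r. ennreal (h y) \<partial>lborel)"
  defines "V \<equiv> unit_ball_vol (real DIM('a))"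
  shows "emeasure lborel S \<le> ennreal (2 * 5 ^ DIM('a) * V / t) *
      (\<integral>\<^sup>+y. ennreal (h y) * indicator {y. t / (2 * V) < h y} y \<partial>lborel)"
proof -
  have V: "0 < V" unfolding V_def by (simp add: unit_ball_vol_pos)
  define H where "H y = ennreal (h y) * indicator {y. t / (2 * V) < h y} y" for y
  have [measurable]: "h \<in> borel_measurable borel" by (fact h)
  have Hm[measurable]: "H \<in> borel_measurable borel" unfolding H_def by measurable
  obtain r where r: "\<And>x. x \<in> S \<Longrightarrow> 0 < r x \<and> r x \<le> B"
    and rt: "\<And>x. x \<in> S \<Longrightarrow> ennreal (t * r x ^ DIM('a)) < (\<integral>\<^sup>+y\<in>ball x (r x). ennreal (h y) \<partial>lborel)"
    using avg by metis
  define \<kappa> where "\<kappa> = 2 * 5 ^ DIM('a) * V / t"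
  have ball: "emeasure lborel (ball x (5 * r x)) \<le> ennreal \<kappa> * emeasure (density lborel H) (ball x (r x))"
    if "x \<in> S" for x
  proof -
    define c where "c = t * r x ^ DIM('a) / 2"
    have rx: "0 < r x" and c: "0 \<le> c" using r[OF that] \<open>0 < t\<close> by (auto simp: c_def)
    have "ennreal c + ennreal c < (\<integral>\<^sup>+y\<in>ball x (r x). ennreal (h y) \<partial>lborel)"
      using rt[OF that] c by (simp add: c_def ennreal_plus[symmetric] del: ennreal_plus)
    also have "\<dots> \<le> (\<integral>\<^sup>+y. H y * indicator (ball x (r x)) y + ennreal (t / (2 * V)) * indicator (ball x (r x)) y \<partial>lborel)"
      by (intro nn_integral_mono) (auto simp: H_def indicator_def intro: ennreal_leI)
    also have "\<dots> = (\<integral>\<^sup>+y\<in>ball x (r x). H y \<partial>lborel) + ennreal (t / (2 * V)) * emeasure lborel (ball x (r x))"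
      by (subst nn_integral_add)
        (auto simp: nn_integral_cmult_indicator intro!: borel_measurable_times_ennreal borel_measurable_indicator)
    also have "ennreal (t / (2 * V)) * emeasure lborel (ball x (r x)) = ennreal c"
      using rx V \<open>0 < t\<close> by (simp add: emeasure_ball V_def[symmetric] ennreal_mult[symmetric] c_def)
    finally have "\<not> (\<integral>\<^sup>+y\<in>ball x (r x). H y \<partial>lborel) \<le> ennreal c"
      using add_right_mono[of "\<integral>\<^sup>+y\<in>ball x (r x). H y \<partial>lborel" "ennreal c" "ennreal c"] by (meson leD)
    then have "ennreal c \<le> (\<integral>\<^sup>+y\<in>ball x (r x). H y \<partial>lborel)"
      by (meson linear)
    then have "ennreal \<kappa> * ennreal c \<le> ennreal \<kappa> * emeasure (density lborel H) (ball x (r x))"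
      by (simp add: emeasure_density mult_left_mono)
    moreover have "ennreal \<kappa> * ennreal c = emeasure lborel (ball x (5 * r x))"
      using rx V c \<open>0 < t\<close>
      by (simp add: emeasure_ball V_def[symmetric] ennreal_mult[symmetric] c_def \<kappa>_def power_mult_distrib field_simps)
    ultimately show ?thesis by simp
  qed
  obtain C where C: "countable C" "C \<subseteq> S"
     "pairwise (\<lambda>i j. disjnt (ball i (r i)) (ball j (r j))) C"
     "S \<subseteq> (\<Union>i\<in>C. ball i (5 * r i))"
    by (rule Vitali_covering_lemma_balls[where S=S and K=S and a="\<lambda>x. x" and r=r and B=B]) (use r in auto)
  \<comment> \<open>The centres are indexed by natural numbers for countable additivity and
    subadditivity; indices outside \<open>N\<close> receive empty sets, which covers a finite
    \<open>C\<close> as well.\<close>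
  define N where "N = to_nat_on C ` C"
  define c where "c = from_nat_into C"
  have cN: "c k \<in> C" if "k \<in> N" for k using that C(1) by (auto simp: N_def c_def)
  have c_inj: "i = j" if "i \<in> N" "j \<in> N" "c i = c j" for i j
    using that C(1) by (auto simp: N_def c_def)
  have c_surj: "\<exists>k\<in>N. c k = x" if "x \<in> C" for x using that C(1) by (auto simp: N_def c_def)
  define E where "E k = (if k \<in> N then ball (c k) (5 * r (c k)) else {})" for k
  define D where "D k = (if k \<in> N then ball (c k) (r (c k)) else {})" for k
  have "disjoint_family D"
    unfolding disjoint_family_on_def
  proof (intro ballI impI)
    fix i j :: nat assume "i \<noteq> j"
    show "D i \<inter> D j = {}"
    proof (cases "i \<in> N \<and> j \<in> N")
      case True
      then have "c i \<noteq> c j" using c_inj \<open>i \<noteq> j\<close> by blast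
      then have "disjnt (ball (c i) (r (c i))) (ball (c j) (r (c j)))"
        using True cN by (intro pairwiseD[OF C(3)]) auto
      then show ?thesis using True by (simp add: D_def disjnt_def)
    qed (auto simp: D_def)
  qed
  have "S \<subseteq> (\<Union>k. E k)"
  proof
    fix x assume "x \<in> S"
    then obtain i where i: "i \<in> C" "x \<in> ball i (5 * r i)" using C(4) by blast
    then obtain k where "k \<in> N" "c k = i" using c_surj by blast
    then show "x \<in> (\<Union>k. E k)" using i by (auto simp: E_def)
  qed
  then have "emeasure lborel S \<le> emeasure lborel (\<Union>k. E k)"
    by (intro emeasure_mono) (auto simp: E_def)
  also have "\<dots> \<le> (\<Sum>k. emeasure lborel (E k))"
    by (intro emeasure_subadditive_countably) (auto simp: E_def)
  also have "\<dots> \<le> (\<Sum>k. ennreal \<kappa> * emeasure (density lborel H) (D k))"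
    using ball cN C(2) by (intro suminf_le) (auto simp: E_def D_def)
  also have "\<dots> = ennreal \<kappa> * (\<Sum>k. emeasure (density lborel H) (D k))" by simp
  also have "(\<Sum>k. emeasure (density lborel H) (D k)) = emeasure (density lborel H) (\<Union>k. D k)"
    by (rule suminf_emeasure[OF _ \<open>disjoint_family D\<close>]) (auto simp: D_def)
  also have "\<dots> \<le> emeasure (density lborel H) UNIV"
    by (intro emeasure_mono) auto
  also have "\<dots> = (\<integral>\<^sup>+y. H y \<partial>lborel)"
    by (simp add: emeasure_density)
  finally have "emeasure lborel S \<le> ennreal \<kappa> * (\<integral>\<^sup>+y. H y \<partial>lborel)"
    by (simp add: mult_left_mono)
  then show ?thesis unfolding H_def \<kappa>_def .
qed

lemma nn_integral_powr_from_0: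
  fixes e M :: real
  assumes "0 < e" "0 \<le> M"
  shows "(\<integral>\<^sup>+t. (if 0 < t \<and> t < M then ennreal (t powr (e - 1)) else 0) \<partial>lborel) = ennreal (M powr e / e)"
proof -
  have "((\<lambda>t. t powr (e - 1)) has_integral (M powr (e - 1 + 1) / (e - 1 + 1))) {0..M}"
    using assms by (intro has_integral_powr_from_0) auto
  then have "(\<integral>\<^sup>+t. ennreal (t powr (e - 1)) * indicator {0..M} t \<partial>lborel) = ennreal (M powr e / e)"
    by (subst nn_integral_has_integral_lebesgue') auto
  moreover have "(\<integral>\<^sup>+t. (if 0 < t \<and> t < M then ennreal (t powr (e - 1)) else 0) \<partial>lborel)
      = (\<integral>\<^sup>+t. ennreal (t powr (e - 1)) * indicator {0..M} t \<partial>lborel)"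
    using AE_lborel_singleton[of 0] AE_lborel_singleton[of M]
    by (intro nn_integral_cong_AE, eventually_elim) (auto simp: indicator_def)
  ultimately show ?thesis by simp
qed

text \<open>The Hardy--Littlewood maximal theorem, for a function \<open>m\<close> below the maximal function of \<open>h\<close>;
  this avoids having to define the latter as a real-valued measurable function.\<close>
lemma maximal_strong_type:
  fixes h m :: "'a::euclidean_space \<Rightarrow> real"
  assumes h: "h \<in> borel_measurable borel" "\<And>x. 0 \<le> h x"
    and m: "m \<in> borel_measurable borel" "\<And>x. 0 \<le> m x"
    and "1 < s"
    and avg: "\<And>x t. 0 < t \<Longrightarrow> t < m x \<Longrightarrow>
      \<exists>r>0. r \<le> B \<and> ennreal (t * r ^ DIM('a)) < (\<integral>\<^sup>+y\<in>ball x r. ennreal (h y) \<partial>lborel)"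
  defines "V \<equiv> unit_ball_vol (real DIM('a))"
  shows "(\<integral>\<^sup>+x. ennreal (m x powr s) \<partial>lborel)
    \<le> ennreal (s * (2 * 5 ^ DIM('a) * V) * (2 * V) powr (s - 1) / (s - 1)) * (\<integral>\<^sup>+y. ennreal (h y powr s) \<partial>lborel)"
proof -
  have V: "0 < V" unfolding V_def by (simp add: unit_ball_vol_pos)
  have [measurable]: "h \<in> borel_measurable borel" "m \<in> borel_measurable borel" by fact+
  \<comment> \<open>The argument combines the layer-cake formula, which writes
    \<open>m x powr s\<close> as the integral of \<open>s * t powr (s - 1)\<close> over
    \<open>0 < t < m x\<close>, with the weak type bound at each level \<open>t\<close> and Fubini.
    The factor \<open>1 / t\<close> of the weak bound lowers the power to \<open>s - 2\<close>,
    still integrable at 0 because \<open>s > 1\<close>; \<open>D\<close> collects what does not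
    depend on \<open>t\<close>.\<close>
  define D where "D = s * (2 * 5 ^ DIM('a) * V)"
  have D: "0 \<le> D" using V \<open>1 < s\<close> by (simp add: D_def)
  have "(\<integral>\<^sup>+x. ennreal (m x powr s) \<partial>lborel)
      = (\<integral>\<^sup>+x. (\<integral>\<^sup>+t. ennreal s * (if 0 < t \<and> t < m x then ennreal (t powr (s - 1)) else 0) \<partial>lborel) \<partial>lborel)"
  proof (rule nn_integral_cong)
    fix x
    have "(\<integral>\<^sup>+t. ennreal s * (if 0 < t \<and> t < m x then ennreal (t powr (s - 1)) else 0) \<partial>lborel)
       = ennreal s * (\<integral>\<^sup>+t. (if 0 < t \<and> t < m x then ennreal (t powr (s - 1)) else 0) \<partial>lborel)"
      by (rule nn_integral_cmult) measurable
    also have "\<dots> = ennreal s * ennreal (m x powr s / s)"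
      using \<open>1 < s\<close> m by (simp add: nn_integral_powr_from_0)
    also have "\<dots> = ennreal (m x powr s)"
      using \<open>1 < s\<close> by (simp add: ennreal_mult[symmetric])
    finally show "ennreal (m x powr s) = (\<integral>\<^sup>+t. ennreal s * (if 0 < t \<and> t < m x then ennreal (t powr (s - 1)) else 0) \<partial>lborel)" ..
  qed
  also have "\<dots> = (\<integral>\<^sup>+t. (\<integral>\<^sup>+x. ennreal s * (if 0 < t \<and> t < m x then ennreal (t powr (s - 1)) else 0) \<partial>lborel) \<partial>lborel)"
    by (rule lborel_pair.Fubini'[symmetric]) measurable
  also have "\<dots> \<le> (\<integral>\<^sup>+t. (\<integral>\<^sup>+y. ennreal D * (ennreal (h y) * (if 0 < t \<and> t < 2 * V * h y then ennreal (t powr (s - 1 - 1)) else 0)) \<partial>lborel) \<partial>lborel)"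
  proof (rule nn_integral_mono)
    fix t :: real
    show "(\<integral>\<^sup>+x. ennreal s * (if 0 < t \<and> t < m x then ennreal (t powr (s - 1)) else 0) \<partial>lborel)
       \<le> (\<integral>\<^sup>+y. ennreal D * (ennreal (h y) * (if 0 < t \<and> t < 2 * V * h y then ennreal (t powr (s - 1 - 1)) else 0)) \<partial>lborel)"
    proof (cases "0 < t")
      case True
      have "(\<integral>\<^sup>+x. ennreal s * (if 0 < t \<and> t < m x then ennreal (t powr (s - 1)) else 0) \<partial>lborel)
          = (\<integral>\<^sup>+x. ennreal (s * t powr (s - 1)) * indicator {x. t < m x} x \<partial>lborel)"
        using True \<open>1 < s\<close> by (intro nn_integral_cong) (auto simp: ennreal_mult)
      also have "\<dots> = ennreal (s * t powr (s - 1)) * emeasure lborel {x. t < m x}"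
        by (rule nn_integral_cmult_indicator) measurable
      also have "\<dots> \<le> ennreal (s * t powr (s - 1)) * (ennreal (2 * 5 ^ DIM('a) * V / t) *
         (\<integral>\<^sup>+y. ennreal (h y) * indicator {y. t / (2 * V) < h y} y \<partial>lborel))"
        unfolding V_def using avg[OF True] h True
        by (intro mult_left_mono emeasure_maximal_superlevel) auto
      also have "\<dots> = ennreal (D * t powr (s - 1 - 1)) *
         (\<integral>\<^sup>+y. ennreal (h y) * indicator {y. t / (2 * V) < h y} y \<partial>lborel)"
        using True \<open>1 < s\<close> V unfolding mult.assoc[symmetric]
        by (subst ennreal_mult[symmetric]) (auto simp: D_def powr_diff field_simps power2_eq_square)
      also have "\<dots> = (\<integral>\<^sup>+y. ennreal (D * t powr (s - 1 - 1)) * (ennreal (h y) * indicator {y. t / (2 * V) < h y} y) \<partial>lborel)"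
        by (rule nn_integral_cmult[symmetric]) measurable
      also have "\<dots> = (\<integral>\<^sup>+y. ennreal D * (ennreal (h y) * (if 0 < t \<and> t < 2 * V * h y then ennreal (t powr (s - 1 - 1)) else 0)) \<partial>lborel)"
        using True V D by (intro nn_integral_cong) (auto simp: ennreal_mult field_simps indicator_def)
      finally show ?thesis .
    qed auto
  qed
  also have "\<dots> = (\<integral>\<^sup>+y. (\<integral>\<^sup>+t. ennreal D * (ennreal (h y) * (if 0 < t \<and> t < 2 * V * h y then ennreal (t powr (s - 1 - 1)) else 0)) \<partial>lborel) \<partial>lborel)"
    by (rule lborel_pair.Fubini') measurable
  also have "\<dots> = (\<integral>\<^sup>+y. ennreal (D * (2 * V) powr (s - 1) / (s - 1)) * ennreal (h y powr s) \<partial>lborel)"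
  proof (rule nn_integral_cong)
    fix y
    have "(\<integral>\<^sup>+t. ennreal D * (ennreal (h y) * (if 0 < t \<and> t < 2 * V * h y then ennreal (t powr (s - 1 - 1)) else 0)) \<partial>lborel)
      = ennreal D * (ennreal (h y) * (\<integral>\<^sup>+t. (if 0 < t \<and> t < 2 * V * h y then ennreal (t powr (s - 1 - 1)) else 0) \<partial>lborel))"
    proof (subst nn_integral_cmult)
      show "ennreal D * (\<integral>\<^sup>+t. ennreal (h y) * (if 0 < t \<and> t < 2 * V * h y then ennreal (t powr (s - 1 - 1)) else 0) \<partial>lborel)
        = ennreal D * (ennreal (h y) * (\<integral>\<^sup>+t. (if 0 < t \<and> t < 2 * V * h y then ennreal (t powr (s - 1 - 1)) else 0) \<partial>lborel))"
        by (rule arg_cong[OF nn_integral_cmult]) measurable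
    qed measurable
    also have "\<dots> = ennreal D * (ennreal (h y) * ennreal ((2 * V * h y) powr (s - 1) / (s - 1)))"
      using \<open>1 < s\<close> h V by (subst nn_integral_powr_from_0) auto
    also have "\<dots> = ennreal (D * (h y * ((2 * V * h y) powr (s - 1) / (s - 1))))"
      using D h \<open>1 < s\<close> by (simp add: ennreal_mult[symmetric])
    also have "h y * ((2 * V * h y) powr (s - 1) / (s - 1)) = (2 * V) powr (s - 1) / (s - 1) * h y powr s"
      using h(2)[of y] V by (cases "h y = 0") (auto simp: powr_mult powr_diff)
    finally show "(\<integral>\<^sup>+t. ennreal D * (ennreal (h y) * (if 0 < t \<and> t < 2 * V * h y then ennreal (t powr (s - 1 - 1)) else 0)) \<partial>lborel)
       = ennreal (D * (2 * V) powr (s - 1) / (s - 1)) * ennreal (h y powr s)"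
      using D \<open>1 < s\<close> by (simp add: ennreal_mult[symmetric])
  qed
  also have "\<dots> = ennreal (D * (2 * V) powr (s - 1) / (s - 1)) * (\<integral>\<^sup>+y. ennreal (h y powr s) \<partial>lborel)"
    by (rule nn_integral_cmult) measurable
  finally show ?thesis by (simp add: D_def)
qed

section \<open>From averages over rays to averages over balls\<close>

lemma nn_integral_unit_ball_scale:
  fixes g :: "'a::euclidean_space \<Rightarrow> ennreal"
  assumes [measurable]: "g \<in> borel_measurable borel" and "0 < s"
  shows "(\<integral>\<^sup>+v\<in>ball 0 1. g (x + s *\<^sub>R v) \<partial>lborel) = ennreal (s powr - real DIM('a)) * (\<integral>\<^sup>+y\<in>ball x s. g y \<partial>lborel)"
proof -
  have [measurable]: "ball (0::'a) 1 \<in> sets borel" by simp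
  have "(\<integral>\<^sup>+y\<in>ball x s. g y \<partial>lborel)
     = (\<integral>\<^sup>+y. g y * indicator (ball x s) y \<partial>density (distr lborel borel (\<lambda>v. x + s *\<^sub>R v)) (\<lambda>_. \<bar>s\<bar> ^ DIM('a)))"
    using assms lborel_affine[of s x] by simp
  also have "\<dots> = (\<integral>\<^sup>+v. ennreal (s ^ DIM('a)) * (g (x + s *\<^sub>R v) * indicator (ball x s) (x + s *\<^sub>R v)) \<partial>lborel)"
  proof (subst nn_integral_density)
    show "(\<lambda>y. g y * indicator (ball x s) y) \<in> borel_measurable (distr lborel borel (\<lambda>v. x + s *\<^sub>R v))"
      by (simp add: borel_measurable_times_ennreal borel_measurable_indicator)
    then show "(\<integral>\<^sup>+y. ennreal (\<bar>s\<bar> ^ DIM('a)) * (g y * indicator (ball x s) y) \<partial>distr lborel borel (\<lambda>v. x + s *\<^sub>R v))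
      = (\<integral>\<^sup>+v. ennreal (s ^ DIM('a)) * (g (x + s *\<^sub>R v) * indicator (ball x s) (x + s *\<^sub>R v)) \<partial>lborel)"
      using \<open>0 < s\<close> by (subst nn_integral_distr) auto
  qed auto
  also have "\<dots> = (\<integral>\<^sup>+v. ennreal (s ^ DIM('a)) * (g (x + s *\<^sub>R v) * indicator (ball 0 1) v) \<partial>lborel)"
    using assms by (intro nn_integral_cong) (auto simp: indicator_def dist_norm)
  also have "\<dots> = ennreal (s ^ DIM('a)) * (\<integral>\<^sup>+v\<in>ball 0 1. g (x + s *\<^sub>R v) \<partial>lborel)"
    by (rule nn_integral_cmult) measurable
  finally show ?thesis
    using assms by (simp add: mult.assoc[symmetric] ennreal_mult[symmetric] powr_minus powr_realpow)
qed

text \<open>Averaging the fundamental theorem of calculus along the rays \<open>x + s v\<close> over an annulus of directions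
  \<open>v\<close>. The lower bound \<open>1/2 \<le> |v|\<close> makes all rays leave the support at the same time \<open>2R\<close>.\<close>
lemma C1_le_nn_integral_averages:
  fixes f :: "'a::euclidean_space \<Rightarrow> real" and g :: "'a \<Rightarrow> 'a"
  assumes deriv: "\<And>z. GDERIV f z :> g z" and cont: "continuous_on UNIV g"
    and "0 < R" and supp: "\<And>z. R \<le> dist x z \<Longrightarrow> f z = 0"
  shows "ennreal (unit_ball_vol (real DIM('a)) * (1 - (1/2) ^ DIM('a))) * ennreal \<bar>f x\<bar>
    \<le> (\<integral>\<^sup>+s\<in>{0<..<2*R}. ennreal (s powr - real DIM('a)) * (\<integral>\<^sup>+y\<in>ball x s. ennreal (norm (g y)) \<partial>lborel) \<partial>lborel)"
proof -
  define A where "A = ball (0::'a) 1 - ball 0 (1/2)"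
  have [measurable]: "ball (0::'a) 1 \<in> sets borel" "A \<in> sets borel" by (simp_all add: A_def)
  have [measurable]: "g \<in> borel_measurable borel"
    using cont by (rule borel_measurable_continuous_onI)
  have ray: "ennreal \<bar>f x\<bar> \<le> (\<integral>\<^sup>+s\<in>{0<..<2*R}. ennreal (norm (g (x + s *\<^sub>R v))) \<partial>lborel)" if "v \<in> A" for v
  proof -
    have v: "1/2 \<le> norm v" "norm v < 1" using that by (auto simp: A_def)
    have "((\<lambda>s. g (x + s *\<^sub>R v) \<bullet> v) has_integral (f (x + (2*R) *\<^sub>R v) - f (x + 0 *\<^sub>R v))) {0..2*R}"
    proof (rule fundamental_theorem_of_calculus)
      fix s assume "s \<in> {0..2*R}"
      have "((\<lambda>s. f (x + s *\<^sub>R v)) has_derivative (\<lambda>h. (g (x + s *\<^sub>R v)) \<bullet> (h *\<^sub>R v))) (at s within {0..2*R})"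
      proof (rule has_derivative_compose[of "\<lambda>s. x + s *\<^sub>R v" "\<lambda>h. h *\<^sub>R v" s "{0..2*R}" f "\<lambda>k. g (x + s *\<^sub>R v) \<bullet> k"])
        show "((\<lambda>s. x + s *\<^sub>R v) has_derivative (\<lambda>h. h *\<^sub>R v)) (at s within {0..2*R})"
          by (auto intro!: derivative_eq_intros)
        show "(f has_derivative (\<lambda>k. g (x + s *\<^sub>R v) \<bullet> k)) (at (x + s *\<^sub>R v))"
          using deriv[of "x + s *\<^sub>R v"] by (simp add: gderiv_def inner_commute)
      qed
      then show "((\<lambda>s. f (x + s *\<^sub>R v)) has_vector_derivative g (x + s *\<^sub>R v) \<bullet> v) (at s within {0..2*R})"
        by (simp add: has_vector_derivative_def)
    qed (use \<open>0 < R\<close> in auto)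
    moreover have "f (x + (2*R) *\<^sub>R v) = 0"
    proof (rule supp)
      have "R * 1 \<le> R * (2 * norm v)" using v \<open>0 < R\<close> by (intro mult_left_mono) auto
      then show "R \<le> dist x (x + (2*R) *\<^sub>R v)" using \<open>0 < R\<close> by (simp add: dist_norm mult.assoc)
    qed
    ultimately have ftc: "((\<lambda>s. g (x + s *\<^sub>R v) \<bullet> v) has_integral (- f x)) {0..2*R}" by simp
    have cont': "continuous_on {0..2*R} (\<lambda>s. norm (g (x + s *\<^sub>R v)))"
      by (intro continuous_intros continuous_on_compose2[OF cont]) auto
    then obtain I where I: "((\<lambda>s. norm (g (x + s *\<^sub>R v))) has_integral I) {0..2*R}"
      using integrable_continuous_real by blast
    have "norm (g z \<bullet> v) \<le> norm (g z)" for z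
    proof -
      have "norm (g z \<bullet> v) \<le> norm (g z) * norm v" by (simp add: Cauchy_Schwarz_ineq2)
      also have "\<dots> \<le> norm (g z) * 1" using v by (intro mult_left_mono) auto
      finally show ?thesis by simp
    qed
    then have "norm (integral {0..2*R} (\<lambda>s. g (x + s *\<^sub>R v) \<bullet> v)) \<le> integral {0..2*R} (\<lambda>s. norm (g (x + s *\<^sub>R v)))"
      using ftc I by (intro Henstock_Kurzweil_Integration.integral_norm_bound_integral) auto
    then have "\<bar>f x\<bar> \<le> I" using ftc I by (simp add: integral_unique)
    then have "ennreal \<bar>f x\<bar> \<le> ennreal I" by (rule ennreal_leI)
    also have "\<dots> = (\<integral>\<^sup>+s\<in>{0..2*R}. ennreal (norm (g (x + s *\<^sub>R v))) \<partial>lborel)"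
      by (rule nn_integral_has_integral_lebesgue'[OF _ I, symmetric]) simp
    also have "\<dots> = (\<integral>\<^sup>+s\<in>{0<..<2*R}. ennreal (norm (g (x + s *\<^sub>R v))) \<partial>lborel)"
      using AE_lborel_singleton[of 0] AE_lborel_singleton[of "2*R"]
      by (intro nn_integral_cong_AE, eventually_elim) (auto simp: indicator_def)
    finally show ?thesis .
  qed
  have "emeasure lborel A = emeasure lborel (ball (0::'a) 1) - emeasure lborel (ball (0::'a) (1/2))"
    unfolding A_def by (rule emeasure_Diff) (auto simp: emeasure_ball intro: subset_ball)
  also have "\<dots> = ennreal (unit_ball_vol (real DIM('a)) * (1 - (1/2) ^ DIM('a)))"
    by (simp add: emeasure_ball ennreal_minus algebra_simps)
  finally have A: "emeasure lborel A = ennreal (unit_ball_vol (real DIM('a)) * (1 - (1/2) ^ DIM('a)))" .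
  have "ennreal (unit_ball_vol (real DIM('a)) * (1 - (1/2) ^ DIM('a))) * ennreal \<bar>f x\<bar>
      = (\<integral>\<^sup>+v. ennreal \<bar>f x\<bar> * indicator A v \<partial>lborel)"
    by (subst nn_integral_cmult_indicator) (simp_all add: A mult.commute)
  \<comment> \<open>The annulus is enlarged to the unit ball only on the right, where full balls are
    wanted; on the left its measure has already produced the constant.\<close>
  also have "\<dots> \<le> (\<integral>\<^sup>+v. (\<integral>\<^sup>+s. ennreal (norm (g (x + s *\<^sub>R v))) * (indicator {0<..<2*R} s * indicator (ball 0 1) v) \<partial>lborel) \<partial>lborel)"
  proof (rule nn_integral_mono)
    fix v
    show "ennreal \<bar>f x\<bar> * indicator A v \<le> (\<integral>\<^sup>+s. ennreal (norm (g (x + s *\<^sub>R v))) * (indicator {0<..<2*R} s * indicator (ball 0 1) v) \<partial>lborel)"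
      using ray[of v] by (cases "v \<in> A") (auto simp: A_def)
  qed
  also have "\<dots> = (\<integral>\<^sup>+s. (\<integral>\<^sup>+v. ennreal (norm (g (x + s *\<^sub>R v))) * (indicator {0<..<2*R} s * indicator (ball 0 1) v) \<partial>lborel) \<partial>lborel)"
    by (rule lborel_pair.Fubini') measurable
  also have "\<dots> = (\<integral>\<^sup>+s\<in>{0<..<2*R}. ennreal (s powr - real DIM('a)) * (\<integral>\<^sup>+y\<in>ball x s. ennreal (norm (g y)) \<partial>lborel) \<partial>lborel)"
  proof (rule nn_integral_cong)
    fix s
    show "(\<integral>\<^sup>+v. ennreal (norm (g (x + s *\<^sub>R v))) * (indicator {0<..<2*R} s * indicator (ball 0 1) v) \<partial>lborel)
      = ennreal (s powr - real DIM('a)) * (\<integral>\<^sup>+y\<in>ball x s. ennreal (norm (g y)) \<partial>lborel) * indicator {0<..<2*R} s"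
      by (cases "s \<in> {0<..<2*R}") (auto simp: nn_integral_unit_ball_scale[where g="\<lambda>y. ennreal (norm (g y))"])
  qed
  finally show ?thesis .
qed

subsection \<open>Averages of functions in the unit ball of the Morrey space\<close>

lemma emeasure_ball_powr:
  "0 < r \<Longrightarrow> emeasure lborel (ball (x::'a::euclidean_space) r) = ennreal (unit_ball_vol (real DIM('a)) * r powr real DIM('a))"
  by (simp add: emeasure_ball powr_realpow)

lemma add_powr_le:
  fixes u v e :: real
  assumes "0 \<le> u" "0 \<le> v" "0 \<le> e"
  shows "(u + v) powr e \<le> 2 powr e * (u powr e + v powr e)"
proof -
  have "(u + v) powr e \<le> (2 * max u v) powr e" using assms by (intro powr_mono2) auto
  also have "\<dots> = 2 powr e * max u v powr e" using assms by (simp add: powr_mult)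
  also have "\<dots> \<le> 2 powr e * (u powr e + v powr e)"
    by (intro mult_left_mono) (auto simp: max_def)
  finally show ?thesis .
qed

text \<open>The exponents are Borel functions on the whole space with values in \<open>[\<sigma>, Q]\<close>; outside \<open>\<Omega>\<close>, where the
  functions considered vanish, their values do not matter. Log-Hoelder continuity enters only through the
  constant \<open>K\<close>.\<close>
locale morrey_data =
  fixes \<Omega> :: "'a::euclidean_space set" and p q lam :: "'a \<Rightarrow> real" and a b R \<sigma> Q \<nu> K N :: real
  assumes N_eq: "N = real DIM('a)" and zero_in: "0 \<in> \<Omega>"
    and R_ge: "1 \<le> R" and norm_less: "x \<in> \<Omega> \<Longrightarrow> norm x < R / 2"
    and p_borel[measurable]: "p \<in> borel_measurable borel"
    and q_borel[measurable]: "q \<in> borel_measurable borel"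
    and \<sigma>_gt: "1 < \<sigma>" and \<sigma>_le: "\<sigma> \<le> p x" and p_le_q: "p x \<le> q x" and q_le: "q x \<le> Q"
    and \<nu>_pos: "0 < \<nu>" and lam_ge: "x \<in> \<Omega> \<Longrightarrow> \<nu> \<le> lam x"
    and lam_le: "x \<in> \<Omega> \<Longrightarrow> lam x \<le> N - \<nu>"
    and K_ge: "1 \<le> K"
    and log_p: "x \<in> \<Omega> \<Longrightarrow> y \<in> \<Omega> \<Longrightarrow> 0 < r \<Longrightarrow> r \<le> 6 * R \<Longrightarrow> dist x y \<le> 2 * r \<Longrightarrow> r powr (p x - p y) \<le> K"
    and log_q: "x \<in> \<Omega> \<Longrightarrow> y \<in> \<Omega> \<Longrightarrow> 0 < r \<Longrightarrow> r \<le> 6 * R \<Longrightarrow> dist x y \<le> 2 * r \<Longrightarrow> r powr (q x - q y) \<le> K"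
    and log_lam: "x \<in> \<Omega> \<Longrightarrow> y \<in> \<Omega> \<Longrightarrow> 0 < r \<Longrightarrow> r \<le> 6 * R \<Longrightarrow> dist x y \<le> 2 * r \<Longrightarrow> r powr (lam x - lam y) \<le> K"
    and a_le_b: "a \<le> b" and b_le: "b \<le> a + 1"
    and rel: "x \<in> \<Omega> \<Longrightarrow> (1 + a - b) / (N - lam x) = 1 / p x - 1 / q x"
    and a_gt: "- ((N - lam 0) / q 0) < a"
    and b_lt: "b < N - (N - lam 0) / p 0"
begin

abbreviation "V \<equiv> unit_ball_vol N"
abbreviation "\<mu> x \<equiv> N - lam x"

lemma N_ge: "1 \<le> N" using DIM_ge_Suc0[where 'a='a] by (simp add: N_eq)

lemma V_pos: "0 < V" using N_ge by (simp add: unit_ball_vol_pos)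

lemma emeasure_ball_N: "0 < r \<Longrightarrow> emeasure lborel (ball (x::'a) r) = ennreal (V * r powr N)"
  unfolding N_eq by (rule emeasure_ball_powr)

lemma p_gt: "1 < p x" and q_gt: "1 < q x"
  using \<sigma>_gt \<sigma>_le[of x] p_le_q[of x] by linarith+

lemma Q_gt: "1 < Q" using q_gt[of 0] q_le[of 0] by linarith

lemma p_le: "p x \<le> Q" using p_le_q[of x] q_le[of x] by linarith

lemma mu_ge: "x \<in> \<Omega> \<Longrightarrow> \<nu> \<le> \<mu> x" and mu_le: "x \<in> \<Omega> \<Longrightarrow> \<mu> x \<le> N"
  and mu_pos: "x \<in> \<Omega> \<Longrightarrow> 0 < \<mu> x" and lam_pos: "x \<in> \<Omega> \<Longrightarrow> 0 < lam x"
  and lam_less: "x \<in> \<Omega> \<Longrightarrow> lam x < N"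
  using \<nu>_pos lam_ge[of x] lam_le[of x] by linarith+

lemma K_powr_le: "0 \<le> s \<Longrightarrow> s \<le> t \<Longrightarrow> 0 \<le> u \<Longrightarrow> u \<le> K \<Longrightarrow> u powr s \<le> K powr t"
  using K_ge by (meson powr_mono powr_mono2 order_trans)

lemma mu_p_le: "x \<in> \<Omega> \<Longrightarrow> \<mu> x / p x \<le> N" "x \<in> \<Omega> \<Longrightarrow> \<mu> x / q x \<le> N"
proof -
  assume x: "x \<in> \<Omega>"
  have "\<mu> x / p x \<le> \<mu> x / 1" "\<mu> x / q x \<le> \<mu> x / 1"
    using mu_pos[OF x] p_gt[of x] q_gt[of x] by (intro divide_left_mono; simp)+
  with mu_le[OF x] show "\<mu> x / p x \<le> N" "\<mu> x / q x \<le> N" by simp_all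
qed

text \<open>Modular at most 1, with the negative power of \<open>r\<close> moved to the right-hand
  side. As \<open>G\<close> vanishes off \<Omega>, full balls can stand for their intersections with
  \<Omega>.\<close>

definition morrey_unit :: "('a \<Rightarrow> real) \<Rightarrow> bool" where
  "morrey_unit G \<longleftrightarrow> G \<in> borel_measurable borel \<and> (\<forall>y. 0 \<le> G y) \<and> (\<forall>y. y \<notin> \<Omega> \<longrightarrow> G y = 0) \<and>
    (\<forall>x\<in>\<Omega>. \<forall>r>0. (\<integral>\<^sup>+y\<in>ball x r. ennreal (G y powr p y) \<partial>lborel) \<le> ennreal (r powr lam x))"

lemma morrey_unitD:
  assumes "morrey_unit G"
  shows "G \<in> borel_measurable borel" "0 \<le> G y" "y \<notin> \<Omega> \<Longrightarrow> G y = 0"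
    "x \<in> \<Omega> \<Longrightarrow> 0 < r \<Longrightarrow> (\<integral>\<^sup>+y\<in>ball x r. ennreal (G y powr p y) \<partial>lborel) \<le> ennreal (r powr lam x)"
  using assms unfolding morrey_unit_def by blast+

text \<open>Substitute for Hoelder's inequality: the splitting at level \<open>t\<close> is
  integrated over the ball, and the exponent of \<open>t\<close> is frozen at the centre at the cost
  of \<open>K'\<close>. The level stays free to balance the two terms. The case \<open>e = 1\<close>
  exploits the Morrey bound, the case \<open>e = \<sigma>\<close> an average;
  \<open>e \<le> \<sigma>\<close> keeps \<open>p y / e\<close> at least 1.\<close>

lemma nn_integral_ball_le_young:
  assumes G: "morrey_unit G" and "0 < r" "0 < t" "1 \<le> e" "e \<le> \<sigma>" "0 \<le> K'" "0 \<le> H"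
    and osc: "\<And>y. y \<in> \<Omega> \<Longrightarrow> dist x y < r \<Longrightarrow> t powr ((p x - p y) / e) \<le> K'"
    and H: "(\<integral>\<^sup>+y\<in>ball x r. ennreal (G y powr (p y / e)) \<partial>lborel) \<le> ennreal H"
  shows "(\<integral>\<^sup>+y\<in>ball x r. ennreal (G y) \<partial>lborel) \<le> ennreal (t * (V * r powr N) + K' * t powr (1 - p x / e) * H)"
proof -
  note [measurable] = morrey_unitD(1)[OF G]
  have [measurable]: "ball x r \<in> sets borel" by simp
  define c where "c = K' * t powr (1 - p x / e)"
  have c: "0 \<le> c" using assms by (simp add: c_def)
  have pt: "G y \<le> t + c * G y powr (p y / e)" if "dist x y < r" for y
  proof (cases "y \<in> \<Omega>")
    case True
    have "1 \<le> p y / e" using \<sigma>_le[of y] assms by simp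
    then have "G y \<le> t + G y powr (p y / e) * t powr (1 - p y / e)"
      using morrey_unitD(2)[OF G] assms by (intro le_add_powr_mult_powr) auto
    moreover have "t powr (1 - p y / e) \<le> c"
    proof -
      have "t powr (1 - p y / e) = t powr (1 - p x / e) * t powr ((p x - p y) / e)"
        by (simp add: powr_add[symmetric] diff_divide_distrib)
      also have "\<dots> \<le> t powr (1 - p x / e) * K'"
        using osc[OF True that] by (intro mult_left_mono) auto
      finally show ?thesis by (simp add: c_def mult.commute)
    qed
    then have "G y powr (p y / e) * t powr (1 - p y / e) \<le> G y powr (p y / e) * c"
      by (intro mult_left_mono) auto
    ultimately show ?thesis by (simp add: mult.commute)
  next
    case False
    then show ?thesis using morrey_unitD(3)[OF G] assms c by simp
  qed
  have "(\<integral>\<^sup>+y\<in>ball x r. ennreal (G y) \<partial>lborel)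
     \<le> (\<integral>\<^sup>+y. ennreal t * indicator (ball x r) y + ennreal c * (ennreal (G y powr (p y / e)) * indicator (ball x r) y) \<partial>lborel)"
  proof (rule nn_integral_mono)
    fix y
    show "ennreal (G y) * indicator (ball x r) y
        \<le> ennreal t * indicator (ball x r) y + ennreal c * (ennreal (G y powr (p y / e)) * indicator (ball x r) y)"
      using pt[of y] c \<open>0 < t\<close>
      by (auto simp: indicator_def ennreal_mult[symmetric] ennreal_plus[symmetric] ennreal_leI simp del: ennreal_plus)
  qed
  also have "\<dots> = ennreal t * emeasure lborel (ball x r) + ennreal c * (\<integral>\<^sup>+y\<in>ball x r. ennreal (G y powr (p y / e)) \<partial>lborel)"
    by (subst nn_integral_add, measurable, subst nn_integral_cmult, measurable)
       (auto simp: nn_integral_cmult_indicator)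
  also have "\<dots> \<le> ennreal t * emeasure lborel (ball x r) + ennreal c * ennreal H"
    by (intro add_left_mono mult_left_mono H) auto
  also have "\<dots> = ennreal (t * (V * r powr N) + c * H)"
    using assms c V_pos by (simp add: emeasure_ball_N ennreal_mult[symmetric] ennreal_plus[symmetric] del: ennreal_plus)
  finally show ?thesis by (simp add: c_def)
qed

definition "CA = V + K powr N"

lemma CA_pos: "0 < CA" using V_pos K_ge by (simp add: CA_def add_pos_pos)

text \<open>The level \<open>t = r powr (- (\<mu> x / p x))\<close> makes both terms multiples of
  \<open>r powr (N - \<mu> x / p x)\<close>, the power that Hoelder's inequality yields for constant
  \<open>p\<close>. The oscillation factor is \<open>r powr (p y - p x)\<close> raised to
  \<open>\<mu> x / p x\<close>, which is at most \<open>N\<close>; hence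
  \<open>K powr N\<close>.\<close>

lemma nn_integral_ball_le:
  assumes G: "morrey_unit G" and x: "x \<in> \<Omega>" and r: "0 < r" "r \<le> 6 * R"
  shows "(\<integral>\<^sup>+y\<in>ball x r. ennreal (G y) \<partial>lborel) \<le> ennreal (CA * r powr (N - \<mu> x / p x))"
proof -
  define e where "e = \<mu> x / p x"
  have e: "0 < e" "e \<le> N" using mu_pos[OF x] p_gt[of x] mu_p_le[OF x] by (auto simp: e_def)
  have ep: "e * p x = \<mu> x" using p_gt[of x] by (simp add: e_def)
  have "(\<integral>\<^sup>+y\<in>ball x r. ennreal (G y) \<partial>lborel)
    \<le> ennreal (r powr (- e) * (V * r powr N) + K powr N * (r powr (- e)) powr (1 - p x / 1) * r powr lam x)"
  proof (rule nn_integral_ball_le_young[OF G])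
    fix y assume "y \<in> \<Omega>" "dist x y < r"
    then have "r powr (p y - p x) \<le> K"
      using x r by (intro log_p) (auto simp: dist_commute)
    then have "(r powr (p y - p x)) powr e \<le> K powr N"
      using e by (intro K_powr_le) auto
    then show "(r powr - e) powr ((p x - p y) / 1) \<le> K powr N"
      by (simp add: powr_powr algebra_simps)
  qed (use r \<sigma>_gt morrey_unitD(4)[OF G x] in auto)
  also have "r powr (- e) * (V * r powr N) + K powr N * (r powr (- e)) powr (1 - p x / 1) * r powr lam x
     = CA * r powr (N - e)"
  proof -
    have "(r powr (- e)) powr (1 - p x / 1) * r powr lam x = r powr (N - e)"
      using ep by (simp add: powr_powr powr_add[symmetric] algebra_simps)
    moreover have "r powr (- e) * r powr N = r powr (N - e)" by (simp add: powr_add[symmetric])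
    ultimately show ?thesis by (simp add: CA_def algebra_simps)
  qed
  finally show ?thesis by (simp add: e_def)
qed

text \<open>A priori bound for the integral of \<open>G powr (p y / \<sigma>)\<close> over a ball of
  radius at most \<open>2 * R\<close> centred in \<Omega>; it comes from bounding the integrand by
  \<open>1 + G powr p y\<close>.\<close>

definition "C0 = (V + 1) * (2 * R) powr N"
definition "CB = V + 2 * C0 * K powr N"

lemma C0_ge: "1 \<le> C0"
proof -
  have "1 * 1 \<le> C0" unfolding C0_def using V_pos R_ge N_ge by (intro mult_mono ge_one_powr_ge_zero) auto
  then show ?thesis by simp
qed

text \<open>Diening's estimate: log-Hoelder continuity allows to pull a variable exponent out of an average,
  at the cost of adding \<open>1\<close>.\<close>
lemma nn_integral_ball_le_of_average:
  assumes G: "morrey_unit G" and x: "x \<in> \<Omega>" and r: "0 < r" "r \<le> 2 * R" and "0 \<le> \<tau>"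
    and avg: "(\<integral>\<^sup>+y\<in>ball x r. ennreal (G y powr (p y / \<sigma>)) \<partial>lborel) \<le> ennreal (\<tau> * r powr N)"
  shows "(\<integral>\<^sup>+y\<in>ball x r. ennreal (G y) \<partial>lborel) \<le> ennreal (CB * r powr N * (\<tau> + 1) powr (\<sigma> / p x))"
proof -
  note [measurable] = morrey_unitD(1)[OF G]
  have [measurable]: "ball x r \<in> sets borel" by simp
  have rN: "0 < r powr N" "r powr N \<le> (2 * R) powr N" using r N_ge by (auto intro: powr_mono2)
  \<comment> \<open>The cap forces \<open>\<tau>' + 1\<close> below a multiple of
    \<open>r powr (- N)\<close>. Its powers with exponent \<open>(p x - p y) / p x\<close> then turn
    into powers of \<open>r\<close>, which the log condition controls; for \<tau> itself no such
    bound is available.\<close>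
  define H where "H = min (\<tau> * r powr N) C0"
  define \<tau>' where "\<tau>' = H / r powr N"
  have H: "0 \<le> H" using \<open>0 \<le> \<tau>\<close> C0_ge by (simp add: H_def)
  have \<tau>': "0 \<le> \<tau>'" "\<tau>' \<le> \<tau>" "\<tau>' * r powr N = H"
    using H rN by (auto simp: \<tau>'_def H_def divide_le_eq)
  have \<tau>'_le: "\<tau>' + 1 \<le> 2 * C0 * r powr (- N)"
  proof -
    have "\<tau>' \<le> C0 / r powr N" unfolding \<tau>'_def H_def using rN by (intro divide_right_mono) auto
    moreover have "1 \<le> C0 / r powr N"
    proof -
      have "1 * (2 * R) powr N \<le> C0" unfolding C0_def using V_pos by (intro mult_right_mono) auto
      then show ?thesis using rN by simp
    qed
    ultimately have "\<tau>' + 1 \<le> 2 * (C0 / r powr N)" by linarith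
    then show ?thesis by (simp add: powr_minus divide_inverse mult.assoc)
  qed
  have "(\<integral>\<^sup>+y\<in>ball x r. ennreal (G y powr (p y / \<sigma>)) \<partial>lborel)
     \<le> (\<integral>\<^sup>+y. indicator (ball x r) y + ennreal (G y powr p y) * indicator (ball x r) y \<partial>lborel)"
  proof (rule nn_integral_mono)
    fix y
    have "G y powr (p y / \<sigma>) \<le> 1 + G y powr p y"
    proof (cases "G y \<le> 1")
      case True
      have "G y powr (p y / \<sigma>) \<le> 1"
        using True morrey_unitD(2)[OF G, of y] p_gt[of y] \<sigma>_gt powr_mono2[of "p y / \<sigma>" "G y" 1] by simp
      then show ?thesis by (simp add: add_increasing2)
    next
      case False
      have "p y / \<sigma> \<le> p y / 1" using p_gt[of y] \<sigma>_gt by (intro divide_left_mono) auto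
      then have "G y powr (p y / \<sigma>) \<le> G y powr p y" using False by (intro powr_mono) auto
      then show ?thesis by simp
    qed
    then have "ennreal (G y powr (p y / \<sigma>)) \<le> ennreal (1 + G y powr p y)" by (rule ennreal_leI)
    then show "ennreal (G y powr (p y / \<sigma>)) * indicator (ball x r) y
        \<le> indicator (ball x r) y + ennreal (G y powr p y) * indicator (ball x r) y"
      by (auto simp: indicator_def)
  qed
  also have "\<dots> = emeasure lborel (ball x r) + (\<integral>\<^sup>+y\<in>ball x r. ennreal (G y powr p y) \<partial>lborel)"
    by (subst nn_integral_add) auto
  also have "\<dots> \<le> ennreal (V * r powr N) + ennreal (r powr lam x)"
    using r by (intro add_mono morrey_unitD(4)[OF G x]) (auto simp: emeasure_ball_N)
  also have "\<dots> = ennreal (V * r powr N + r powr lam x)"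
    using V_pos by simp
  also have "\<dots> \<le> ennreal C0"
  proof (rule ennreal_leI)
    have "r powr lam x \<le> (2 * R) powr lam x" using r lam_pos[OF x] by (intro powr_mono2) auto
    also have "\<dots> \<le> (2 * R) powr N" using R_ge lam_less[OF x] by (intro powr_mono) auto
    finally have "r powr lam x \<le> (2 * R) powr N" .
    moreover have "V * r powr N \<le> V * (2 * R) powr N" using rN V_pos by (intro mult_left_mono) auto
    ultimately show "V * r powr N + r powr lam x \<le> C0" by (simp add: C0_def algebra_simps)
  qed
  finally have HH: "(\<integral>\<^sup>+y\<in>ball x r. ennreal (G y powr (p y / \<sigma>)) \<partial>lborel) \<le> ennreal H"
    using avg by (simp add: H_def min_def)
  \<comment> \<open>Chosen such that \<open>t powr (p x / \<sigma>) = \<tau>' + 1\<close>, which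
    makes the second term a multiple of \<open>t * r powr N\<close> like the first. The added 1
    keeps the base at least 1, so that negative exponents \<theta> are harmless.\<close>
  define t where "t = (\<tau>' + 1) powr (\<sigma> / p x)"
  have t: "0 < t" using \<tau>' by (simp add: t_def)
  have "(\<integral>\<^sup>+y\<in>ball x r. ennreal (G y) \<partial>lborel)
    \<le> ennreal (t * (V * r powr N) + (2 * C0 * K powr N) * t powr (1 - p x / \<sigma>) * H)"
  proof (rule nn_integral_ball_le_young[OF G r(1) t _ _ _ H _ HH])
    fix y assume y: "y \<in> \<Omega>" "dist x y < r"
    define \<theta> where "\<theta> = (p x - p y) / p x"
    have "t powr ((p x - p y) / \<sigma>) = (\<tau>' + 1) powr \<theta>"
      using \<sigma>_gt by (simp add: t_def powr_powr \<theta>_def)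
    also have "\<dots> \<le> 2 * C0 * K powr N"
    proof (cases "0 \<le> \<theta>")
      case False
      have "(\<tau>' + 1) powr \<theta> \<le> (\<tau>' + 1) powr 0" using False \<tau>' by (intro powr_mono) auto
      also have "\<dots> \<le> 1 * (1 * 1)" using \<tau>' by simp
      also have "\<dots> \<le> 2 * (C0 * K powr N)"
        using C0_ge K_ge N_ge by (intro mult_mono ge_one_powr_ge_zero) auto
      finally show ?thesis by (simp add: mult.assoc)
    next
      case True
      have \<theta>1: "\<theta> \<le> 1" using p_gt[of x] p_gt[of y] by (simp add: \<theta>_def)
      have \<theta>N: "- (N * \<theta>) = (p y - p x) * N / p x"
        by (simp add: \<theta>_def minus_divide_left algebra_simps)
      have "(\<tau>' + 1) powr \<theta> \<le> (2 * C0 * r powr (- N)) powr \<theta>"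
        using True \<tau>' \<tau>'_le by (intro powr_mono2) auto
      also have "\<dots> = (2 * C0) powr \<theta> * (r powr (p y - p x)) powr (N / p x)"
        using C0_ge \<theta>N by (simp add: powr_mult powr_powr)
      also have "\<dots> \<le> (2 * C0) powr 1 * K powr N"
      proof (intro mult_mono K_powr_le powr_mono)
        show "r powr (p y - p x) \<le> K"
          using x y r R_ge by (intro log_p) (auto simp: dist_commute)
        show "N / p x \<le> N" using p_gt[of x] N_ge divide_left_mono[of 1 "p x" N] by simp
      qed (use \<theta>1 C0_ge p_gt[of x] N_ge in auto)
      finally show ?thesis using C0_ge by simp
    qed
    finally show "t powr ((p x - p y) / \<sigma>) \<le> 2 * C0 * K powr N" .
  qed (use \<sigma>_gt C0_ge in auto)
  also have "t * (V * r powr N) + (2 * C0 * K powr N) * t powr (1 - p x / \<sigma>) * H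
     \<le> CB * r powr N * (\<tau> + 1) powr (\<sigma> / p x)"
  proof -
    have "t powr (p x / \<sigma>) = \<tau>' + 1"
      using \<tau>' \<sigma>_gt p_gt[of x] by (simp add: t_def powr_powr)
    then have "t powr (1 - p x / \<sigma>) * H = t * (\<tau>' / (\<tau>' + 1)) * r powr N"
      using t \<tau>' by (simp add: powr_diff \<tau>'(3)[symmetric])
    also have "\<dots> \<le> t * 1 * r powr N"
      using t \<tau>' by (intro mult_right_mono mult_left_mono) auto
    finally have 1: "t powr (1 - p x / \<sigma>) * H \<le> t * r powr N" by simp
    have "t * (V * r powr N) + (2 * C0 * K powr N) * t powr (1 - p x / \<sigma>) * H
      \<le> t * (V * r powr N) + (2 * C0 * K powr N) * (t * r powr N)"
      using 1 C0_ge unfolding mult.assoc[of "2 * C0 * K powr N"]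
      by (intro add_left_mono mult_left_mono) auto
    also have "\<dots> = CB * r powr N * t" by (simp add: CB_def algebra_simps)
    also have "\<dots> \<le> CB * r powr N * (\<tau> + 1) powr (\<sigma> / p x)"
      using \<tau>' \<sigma>_gt p_gt[of x] V_pos C0_ge unfolding t_def CB_def by (intro mult_left_mono powr_mono2) auto
    finally show ?thesis .
  qed
  finally show ?thesis by (simp add: ennreal_leI)
qed

end

subsection \<open>Pointwise estimates\<close>

context morrey_data
begin

abbreviation "\<beta> \<equiv> \<mu> 0 / q 0"
text \<open>The number \<open>b + \<mu> 0 / p 0\<close> in another form: \<open>a_gt\<close> amounts
  to \<open>\<kappa> > 1\<close> and \<open>b_lt\<close> to \<open>\<kappa> < N\<close>.\<close>

abbreviation "\<kappa> \<equiv> 1 + a + \<beta>"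
definition "CH = 2 powr \<bar>b\<bar> / (1 - 2 powr (b - (N - \<mu> 0 / p 0))) * CA"
text \<open>The 3 comes from enclosing \<open>ball x s\<close> in \<open>ball 0 (3 * s)\<close>, the
  power of 2 from the lower limit \<open>norm x / 2\<close> of the radii.\<close>

definition "CF = CH * 3 powr (N - \<kappa>) * 2 powr (\<kappa> - 1) / (\<kappa> - 1)"

lemma alpha_eq: "x \<in> \<Omega> \<Longrightarrow> 1 + a - b = \<mu> x / p x - \<mu> x / q x"
  using rel[of x] mu_pos[of x] by (simp add: divide_eq_eq) (simp add: algebra_simps)

lemma \<kappa>_gt: "1 < \<kappa>" using a_gt by simp

lemma CH_nonneg: "0 \<le> CH"
proof -
  have "(2::real) powr (b - (N - \<mu> 0 / p 0)) \<le> 2 powr 0" using b_lt by (intro powr_mono) auto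
  then show ?thesis using CA_pos by (simp add: CH_def)
qed

lemma CF_nonneg: "0 \<le> CF"
  unfolding CF_def using CH_nonneg \<kappa>_gt by (intro divide_nonneg_pos mult_nonneg_nonneg) auto

lemma nn_integral_ball_0_le:
  assumes G: "morrey_unit G" and r: "0 < r" "r \<le> 6 * R"
  shows "(\<integral>\<^sup>+y\<in>ball 0 r. ennreal (norm y powr (- b)) * ennreal (G y) \<partial>lborel) \<le> ennreal (CH * r powr (N - \<kappa>))"
proof -
  have "(\<integral>\<^sup>+y\<in>ball 0 r. ennreal (norm y powr (- b)) * ennreal (G y) \<partial>lborel)
      \<le> ennreal (CH * r powr (N - \<mu> 0 / p 0 - b))"
    unfolding CH_def
  proof (rule nn_integral_norm_powr_ball)
    show "(\<integral>\<^sup>+y\<in>ball 0 s. ennreal (G y) \<partial>lborel) \<le> ennreal (CA * s powr (N - \<mu> 0 / p 0))"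
      if "0 < s" "s \<le> r" for s
      using that r by (intro nn_integral_ball_le[OF G zero_in]) auto
  qed (use morrey_unitD(1)[OF G] r b_lt CA_pos in auto)
  also have "N - \<mu> 0 / p 0 - b = N - \<kappa>" using alpha_eq[OF zero_in] by simp
  finally show ?thesis .
qed

text \<open>After recentring, the integrand is a multiple of \<open>s powr (- \<kappa>)\<close>,
  integrable up to infinity; the lower limit produces the power
  \<open>1 - \<kappa> = - a - \<beta>\<close>. Only the exponents at the origin enter.\<close>

lemma far_part_le:
  assumes G: "morrey_unit G" and x: "x \<noteq> 0"
  shows "(\<integral>\<^sup>+s\<in>{norm x / 2..<2 * R}. ennreal (s powr - N) *
      (\<integral>\<^sup>+y\<in>ball x s. ennreal (norm y powr (- b)) * ennreal (G y) \<partial>lborel) \<partial>lborel)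
    \<le> ennreal (CF * norm x powr (- a - \<beta>))"
proof -
  have "(\<integral>\<^sup>+s\<in>{norm x / 2..<2 * R}. ennreal (s powr - N) *
      (\<integral>\<^sup>+y\<in>ball x s. ennreal (norm y powr (- b)) * ennreal (G y) \<partial>lborel) \<partial>lborel)
    \<le> (\<integral>\<^sup>+s. ennreal (CH * 3 powr (N - \<kappa>)) * (ennreal (s powr (- \<kappa>)) * indicator {norm x / 2..} s) \<partial>lborel)"
  proof (rule nn_integral_mono)
    fix s
    show "ennreal (s powr - N) * (\<integral>\<^sup>+y\<in>ball x s. ennreal (norm y powr (- b)) * ennreal (G y) \<partial>lborel) * indicator {norm x / 2..<2 * R} s
      \<le> ennreal (CH * 3 powr (N - \<kappa>)) * (ennreal (s powr (- \<kappa>)) * indicator {norm x / 2..} s)"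
    proof (cases "s \<in> {norm x / 2..<2 * R}")
      case True
      then have s: "0 < s" "norm x \<le> 2 * s" "s < 2 * R" using x by (auto simp: field_simps) (smt (verit) zero_less_norm_iff)
      have "ball x s \<subseteq> ball 0 (3 * s)"
      proof
        fix y assume "y \<in> ball x s"
        then have "dist x y < s" by simp
        moreover have "dist 0 y \<le> dist 0 x + dist x y" by (rule dist_triangle)
        ultimately show "y \<in> ball 0 (3 * s)" using s by simp
      qed
      then have "(\<integral>\<^sup>+y\<in>ball x s. ennreal (norm y powr (- b)) * ennreal (G y) \<partial>lborel)
         \<le> (\<integral>\<^sup>+y\<in>ball 0 (3 * s). ennreal (norm y powr (- b)) * ennreal (G y) \<partial>lborel)"
        by (intro nn_integral_mono) (auto simp: indicator_def)
      also have "\<dots> \<le> ennreal (CH * (3 * s) powr (N - \<kappa>))"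
        using s by (intro nn_integral_ball_0_le[OF G]) auto
      finally have "ennreal (s powr - N) * (\<integral>\<^sup>+y\<in>ball x s. ennreal (norm y powr (- b)) * ennreal (G y) \<partial>lborel)
        \<le> ennreal (s powr - N) * ennreal (CH * (3 * s) powr (N - \<kappa>))"
        by (intro mult_left_mono) auto
      also have "\<dots> = ennreal (s powr - N * (CH * (3 * s) powr (N - \<kappa>)))"
        by (rule ennreal_mult[symmetric]) (use CH_nonneg in auto)
      also have "s powr - N * (CH * (3 * s) powr (N - \<kappa>)) = CH * 3 powr (N - \<kappa>) * s powr (- \<kappa>)"
      proof -
        have "s powr (- N) * s powr (N - \<kappa>) = s powr (- \<kappa>)" by (simp add: powr_add[symmetric] algebra_simps)
        then show ?thesis using s by (simp add: powr_mult mult_ac)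
      qed
      also have "ennreal \<dots> = ennreal (CH * 3 powr (N - \<kappa>)) * ennreal (s powr (- \<kappa>))"
        by (rule ennreal_mult) (use CH_nonneg in auto)
      finally show ?thesis using True by simp
    qed auto
  qed
  also have "\<dots> = ennreal (CH * 3 powr (N - \<kappa>)) * (\<integral>\<^sup>+s\<in>{norm x / 2..}. ennreal (s powr (- \<kappa>)) \<partial>lborel)"
    by (rule nn_integral_cmult) simp
  also have "\<dots> = ennreal (CH * 3 powr (N - \<kappa>)) * ennreal ((norm x / 2) powr (1 - \<kappa>) / (\<kappa> - 1))"
    using x \<kappa>_gt by (subst nn_integral_powr_atLeast) auto
  also have "\<dots> = ennreal (CH * 3 powr (N - \<kappa>) * ((norm x / 2) powr (1 - \<kappa>) / (\<kappa> - 1)))"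
    by (rule ennreal_mult[symmetric]) (use CH_nonneg \<kappa>_gt in auto)
  also have "CH * 3 powr (N - \<kappa>) * ((norm x / 2) powr (1 - \<kappa>) / (\<kappa> - 1)) = CF * norm x powr (- a - \<beta>)"
  proof -
    have "(norm x / 2) powr (1 - \<kappa>) = norm x powr (1 - \<kappa>) * 2 powr (\<kappa> - 1)"
      by (simp add: powr_divide powr_diff powr_minus divide_simps powr_add)
    moreover have "1 - \<kappa> = - a - \<beta>" by simp
    ultimately show ?thesis by (simp only: CF_def mult.assoc times_divide_eq_left times_divide_eq_right mult.commute[of "norm x powr _"])
  qed
  finally show ?thesis .
qed

text \<open>\<open>T\<close> plays the role of the maximal function at \<open>x\<close>. By
  \<open>CA \<le> C\<close> the Morrey bound shares the constant \<open>C\<close>, so averages are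
  at most \<open>C * min T (s powr (- e))\<close>. The weight is of size
  \<open>norm x powr (- b)\<close>, that is
  \<open>norm x powr (- a) * norm x powr (\<alpha> - 1)\<close>, and the second factor is the one
  that the interpolation inequality absorbs.\<close>

lemma near_part_le:
  assumes G: "morrey_unit G" and x: "x \<in> \<Omega>" "x \<noteq> 0" and "0 < T" "CA \<le> C"
    and T: "\<And>s. 0 < s \<Longrightarrow> s \<le> 2 * R \<Longrightarrow> (\<integral>\<^sup>+y\<in>ball x s. ennreal (G y) \<partial>lborel) \<le> ennreal (C * T * s powr N)"
  shows "(\<integral>\<^sup>+s\<in>{0<..<norm x / 2}. ennreal (s powr - N) *
      (\<integral>\<^sup>+y\<in>ball x s. ennreal (norm y powr (- b)) * ennreal (G y) \<partial>lborel) \<partial>lborel)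
    \<le> ennreal (2 powr \<bar>b\<bar> * C * (1 + Q / \<nu>) * (norm x powr (- a) * T powr (p x / q x)))"
proof -
  note [measurable] = morrey_unitD(1)[OF G]
  define \<rho> where "\<rho> = norm x"
  define e where "e = \<mu> x / p x"
  define \<alpha> where "\<alpha> = 1 + a - b"
  have \<rho>: "0 < \<rho>" "\<rho> < R" using x norm_less[OF x(1)] R_ge by (auto simp: \<rho>_def)
  have C: "0 < C" using CA_pos \<open>CA \<le> C\<close> by linarith
  have e\<alpha>: "e - \<alpha> = \<mu> x / q x" using alpha_eq[OF x(1)] by (simp add: e_def \<alpha>_def)
  have e: "0 < e" "\<alpha> < e" using divide_pos_pos[OF mu_pos[OF x(1)], of "p x"] divide_pos_pos[OF mu_pos[OF x(1)], of "q x"] e\<alpha> p_gt[of x] q_gt[of x]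
    unfolding e_def by linarith+
  have "(\<integral>\<^sup>+s\<in>{0<..<\<rho> / 2}. ennreal (s powr - N) *
      (\<integral>\<^sup>+y\<in>ball x s. ennreal (norm y powr (- b)) * ennreal (G y) \<partial>lborel) \<partial>lborel)
    \<le> (\<integral>\<^sup>+s. ennreal (2 powr \<bar>b\<bar> * C * \<rho> powr (- a)) * (ennreal (\<rho> powr (\<alpha> - 1) * min T (s powr (- e))) * indicator {0<..<\<rho>} s) \<partial>lborel)"
  proof (rule nn_integral_mono)
    fix s
    show "ennreal (s powr - N) * (\<integral>\<^sup>+y\<in>ball x s. ennreal (norm y powr (- b)) * ennreal (G y) \<partial>lborel) * indicator {0<..<\<rho> / 2} s
      \<le> ennreal (2 powr \<bar>b\<bar> * C * \<rho> powr (- a)) * (ennreal (\<rho> powr (\<alpha> - 1) * min T (s powr (- e))) * indicator {0<..<\<rho>} s)"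
    proof (cases "s \<in> {0<..<\<rho> / 2}")
      case True
      then have s: "0 < s" "s < \<rho> / 2" "s < \<rho>" using \<rho> by auto
      have w: "norm y powr (- b) \<le> 2 powr \<bar>b\<bar> * \<rho> powr (- b)" if "y \<in> ball x s" for y
      proof -
        have "dist x y < \<rho> / 2" using that s by simp
        then have y: "\<rho> / 2 < norm y" "norm y < 2 * \<rho>"
          using norm_triangle_ineq2[of x y] norm_triangle_ineq2[of y x] \<rho>
          by (auto simp: \<rho>_def dist_norm norm_minus_commute)
        show ?thesis
        proof (cases "0 \<le> b")
          case True
          have "norm y powr (- b) \<le> (\<rho> / 2) powr (- b)"
            using y \<rho> True by (intro powr_mono2') auto
          also have "\<dots> = 2 powr \<bar>b\<bar> * \<rho> powr (- b)"
            using True by (simp add: powr_divide powr_minus field_simps)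
          finally show ?thesis .
        next
          case False
          have "norm y powr (- b) \<le> (2 * \<rho>) powr (- b)"
            using y \<rho> False by (intro powr_mono2) auto
          also have "\<dots> = 2 powr \<bar>b\<bar> * \<rho> powr (- b)"
            using False by (simp add: powr_mult)
          finally show ?thesis .
        qed
      qed
      have "(\<integral>\<^sup>+y\<in>ball x s. ennreal (norm y powr (- b)) * ennreal (G y) \<partial>lborel)
        \<le> (\<integral>\<^sup>+y. ennreal (2 powr \<bar>b\<bar> * \<rho> powr (- b)) * (ennreal (G y) * indicator (ball x s) y) \<partial>lborel)"
        using w by (intro nn_integral_mono) (auto simp: indicator_def intro!: mult_right_mono ennreal_leI)
      also have "\<dots> = ennreal (2 powr \<bar>b\<bar> * \<rho> powr (- b)) * (\<integral>\<^sup>+y\<in>ball x s. ennreal (G y) \<partial>lborel)"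
        by (rule nn_integral_cmult) (auto intro!: borel_measurable_times_ennreal borel_measurable_indicator)
      also have "\<dots> \<le> ennreal (2 powr \<bar>b\<bar> * \<rho> powr (- b)) * ennreal (C * (s powr N * min T (s powr (- e))))"
      proof (rule mult_left_mono)
        have "(\<integral>\<^sup>+y\<in>ball x s. ennreal (G y) \<partial>lborel) \<le> ennreal (CA * s powr (N - e))"
          unfolding e_def using s \<rho> by (intro nn_integral_ball_le[OF G x(1)]) auto
        also have "\<dots> \<le> ennreal (C * s powr (N - e))"
          using \<open>CA \<le> C\<close> by (intro ennreal_leI mult_right_mono) auto
        finally have "(\<integral>\<^sup>+y\<in>ball x s. ennreal (G y) \<partial>lborel) \<le> ennreal (C * (s powr N * s powr (- e)))"
          by (simp add: powr_add[symmetric])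
        moreover have "(\<integral>\<^sup>+y\<in>ball x s. ennreal (G y) \<partial>lborel) \<le> ennreal (C * (s powr N * T))"
          using T[of s] s \<rho> by (simp add: mult_ac)
        ultimately show "(\<integral>\<^sup>+y\<in>ball x s. ennreal (G y) \<partial>lborel) \<le> ennreal (C * (s powr N * min T (s powr (- e))))"
          by (auto simp: min_def)
      qed auto
      finally have "ennreal (s powr - N) * (\<integral>\<^sup>+y\<in>ball x s. ennreal (norm y powr (- b)) * ennreal (G y) \<partial>lborel)
        \<le> ennreal (s powr - N) * (ennreal (2 powr \<bar>b\<bar> * \<rho> powr (- b)) * ennreal (C * (s powr N * min T (s powr (- e)))))"
        by (intro mult_left_mono) auto
      also have "\<dots> = ennreal (s powr - N * (2 powr \<bar>b\<bar> * \<rho> powr (- b) * (C * (s powr N * min T (s powr (- e))))))"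
        using C \<open>0 < T\<close> by (simp add: ennreal_mult)
      also have "s powr - N * (2 powr \<bar>b\<bar> * \<rho> powr (- b) * (C * (s powr N * min T (s powr (- e)))))
         = 2 powr \<bar>b\<bar> * C * \<rho> powr (- a) * (\<rho> powr (\<alpha> - 1) * min T (s powr (- e)))"
      proof -
        have "\<rho> powr (- b) = \<rho> powr (- a) * \<rho> powr (\<alpha> - 1)" by (simp add: \<alpha>_def powr_add[symmetric])
        moreover have "s powr - N * s powr N = 1" using s by (simp add: powr_add[symmetric])
        ultimately show ?thesis by algebra
      qed
      also have "ennreal \<dots> = ennreal (2 powr \<bar>b\<bar> * C * \<rho> powr (- a)) * ennreal (\<rho> powr (\<alpha> - 1) * min T (s powr (- e)))"
        by (rule ennreal_mult) (use C \<open>0 < T\<close> in auto)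
      finally show ?thesis using s by simp
    qed auto
  qed
  also have "\<dots> = ennreal (2 powr \<bar>b\<bar> * C * \<rho> powr (- a)) * (\<integral>\<^sup>+s\<in>{0<..<\<rho>}. ennreal (\<rho> powr (\<alpha> - 1) * min T (s powr (- e))) \<partial>lborel)"
    by (rule nn_integral_cmult) simp
  also have "\<dots> \<le> ennreal (2 powr \<bar>b\<bar> * C * \<rho> powr (- a)) * ennreal ((1 + 1 / (e - \<alpha>)) * T powr ((e - \<alpha>) / e))"
    using a_le_b b_le \<rho> e \<open>0 < T\<close> by (intro mult_left_mono nn_integral_min_powr_le) (auto simp: \<alpha>_def)
  also have "\<dots> = ennreal (2 powr \<bar>b\<bar> * C * \<rho> powr (- a) * ((1 + 1 / (e - \<alpha>)) * T powr ((e - \<alpha>) / e)))"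
    by (rule ennreal_mult[symmetric]) (use C e in auto)
  also have "\<dots> \<le> ennreal (2 powr \<bar>b\<bar> * C * \<rho> powr (- a) * ((1 + Q / \<nu>) * T powr (p x / q x)))"
  proof (rule ennreal_leI)
    \<comment> \<open>Both facts rest on \<open>e - \<alpha> = \<mu> x / q x\<close>; the second one
      makes the constant independent of \<open>x\<close>.\<close>
    have "(e - \<alpha>) / e = p x / q x"
      using mu_pos[OF x(1)] p_gt[of x] q_gt[of x] unfolding e\<alpha> by (simp add: e_def)
    moreover have "1 / (e - \<alpha>) \<le> Q / \<nu>"
      using mu_ge[OF x(1)] \<nu>_pos q_gt[of x] q_le[of x] unfolding e\<alpha> by (simp add: frac_le)
    ultimately show "2 powr \<bar>b\<bar> * C * \<rho> powr (- a) * ((1 + 1 / (e - \<alpha>)) * T powr ((e - \<alpha>) / e))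
       \<le> 2 powr \<bar>b\<bar> * C * \<rho> powr (- a) * ((1 + Q / \<nu>) * T powr (p x / q x))"
      using C by (intro mult_left_mono) (auto intro!: mult_right_mono)
  qed
  finally show ?thesis by (simp add: \<rho>_def mult_ac)
qed

text \<open>The extension by zero, with its gradient carried along as a separate function:
  differentiation takes place on the whole space and the boundary of \<Omega> does not
  intervene.\<close>

definition C1_in :: "('a \<Rightarrow> real) \<Rightarrow> ('a \<Rightarrow> 'a) \<Rightarrow> bool" where
  "C1_in f g \<longleftrightarrow> (\<forall>z. GDERIV f z :> g z) \<and> continuous_on UNIV g \<and> (\<forall>z. z \<notin> \<Omega> \<longrightarrow> f z = 0 \<and> g z = 0)"

text \<open>Measure of the annulus of directions over which the rays are averaged.\<close>

definition "W = V * (1 - (1/2) powr N)"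

lemma W_pos: "0 < W"
proof -
  have "(1/2::real) powr N \<le> (1/2) powr 1" using N_ge by (intro powr_mono') auto
  then show ?thesis using V_pos by (simp add: W_def)
qed

lemma W_eq: "W = unit_ball_vol (real DIM('a)) * (1 - (1/2) ^ DIM('a))"
  unfolding W_def by (simp add: N_eq powr_realpow)

lemma norm_powr_mult_le:
  assumes f: "C1_in f g" and G: "morrey_unit (\<lambda>y. norm y powr b * norm (g y))"
    and x: "x \<in> \<Omega>" "x \<noteq> 0" and "0 < T" "CA \<le> C"
    and T: "\<And>s. 0 < s \<Longrightarrow> s \<le> 2 * R \<Longrightarrow>
      (\<integral>\<^sup>+y\<in>ball x s. ennreal (norm y powr b * norm (g y)) \<partial>lborel) \<le> ennreal (C * T * s powr N)"
  shows "norm x powr a * \<bar>f x\<bar> \<le>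
    (2 powr \<bar>b\<bar> * C * (1 + Q / \<nu>) + CF) / W * (T powr (p x / q x) + norm x powr (- \<beta>))"
proof -
  let ?G = "\<lambda>y. norm y powr b * norm (g y)"
  have [measurable]: "g \<in> borel_measurable borel"
    using f by (auto simp: C1_in_def intro: borel_measurable_continuous_onI)
  define J where "J s = ennreal (s powr - N) * (\<integral>\<^sup>+y\<in>ball x s. ennreal (norm y powr (- b)) * ennreal (?G y) \<partial>lborel)" for s
  define C1 where "C1 = 2 powr \<bar>b\<bar> * C * (1 + Q / \<nu>)"
  have C1: "0 \<le> C1" using \<open>CA \<le> C\<close> CA_pos Q_gt \<nu>_pos by (simp add: C1_def)
  have far: "(\<integral>\<^sup>+s\<in>{norm x / 2..<2 * R}. J s \<partial>lborel) \<le> ennreal (CF * norm x powr (- a - \<beta>))"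
    unfolding J_def using G x(2) by (rule far_part_le)
  have near: "(\<integral>\<^sup>+s\<in>{0<..<norm x / 2}. J s \<partial>lborel) \<le> ennreal (C1 * (norm x powr (- a) * T powr (p x / q x)))"
    unfolding J_def C1_def using assms by (intro near_part_le) auto
  \<comment> \<open>With the indicator of the ball written as a conditional, the integrand is
    visibly measurable jointly in \<open>s\<close> and \<open>y\<close>.\<close>
  have Jm: "J \<in> borel_measurable borel"
  proof -
    have "(\<lambda>s. \<integral>\<^sup>+y. ennreal (norm y powr (- b)) * ennreal (?G y) * (if dist x y < s then 1 else 0) \<partial>lborel) \<in> borel_measurable borel"
      by measurable
    moreover have "(if dist x y < s then 1 else 0) = (indicator (ball x s) y :: ennreal)" for y s
      by (simp add: indicator_def)
    ultimately have "(\<lambda>s. \<integral>\<^sup>+y\<in>ball x s. ennreal (norm y powr (- b)) * ennreal (?G y) \<partial>lborel) \<in> borel_measurable borel"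
      by simp
    then show ?thesis unfolding J_def by measurable
  qed
  have "ennreal (W * \<bar>f x\<bar>) = ennreal W * ennreal \<bar>f x\<bar>"
    by (rule ennreal_mult) (use W_pos in auto)
  also have "\<dots> \<le> (\<integral>\<^sup>+s\<in>{0<..<2*R}. ennreal (s powr - N) * (\<integral>\<^sup>+y\<in>ball x s. ennreal (norm (g y)) \<partial>lborel) \<partial>lborel)"
    unfolding W_eq unfolding N_eq
  proof (rule C1_le_nn_integral_averages)
    show "GDERIV f z :> g z" for z using f by (simp add: C1_in_def)
    show "continuous_on UNIV g" using f by (simp add: C1_in_def)
    show "0 < R" using R_ge by simp
    show "f z = 0" if "R \<le> dist x z" for z
    proof -
      have "dist x z \<le> norm x + norm z" by (simp add: dist_norm norm_triangle_ineq4)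
      then have "z \<notin> \<Omega>" using norm_less[OF x(1)] norm_less[of z] that by linarith
      then show ?thesis using f by (simp add: C1_in_def)
    qed
  qed
  also have "\<dots> = (\<integral>\<^sup>+s\<in>{0<..<2*R}. J s \<partial>lborel)"
  proof -
    have "(\<integral>\<^sup>+y\<in>ball x s. ennreal (norm (g y)) \<partial>lborel)
      = (\<integral>\<^sup>+y\<in>ball x s. ennreal (norm y powr (- b)) * ennreal (?G y) \<partial>lborel)" for s
    proof (rule nn_integral_cong_AE)
      \<comment> \<open>At the origin \<open>0 powr b = 0\<close> destroys the value of
        \<open>g\<close>; the identity holds off this null set.\<close>
      show "AE y in lborel. ennreal (norm (g y)) * indicator (ball x s) y
         = ennreal (norm y powr (- b)) * ennreal (?G y) * indicator (ball x s) y"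
        using AE_lborel_singleton[of "0::'a"]
      proof eventually_elim
        case (elim y)
        then have "norm y powr (- b) * ?G y = norm (g y)"
          by (simp add: mult.assoc[symmetric] powr_add[symmetric])
        then have "ennreal (norm y powr (- b)) * ennreal (?G y) = ennreal (norm (g y))"
          by (subst ennreal_mult[symmetric]) auto
        then show ?case by simp
      qed
    qed
    then show ?thesis by (simp add: J_def)
  qed
  also have "\<dots> \<le> (\<integral>\<^sup>+s. J s * indicator {0<..<norm x / 2} s + J s * indicator {norm x / 2..<2 * R} s \<partial>lborel)"
    by (intro nn_integral_mono) (auto simp: indicator_def)
  also have "\<dots> = (\<integral>\<^sup>+s\<in>{0<..<norm x / 2}. J s \<partial>lborel) + (\<integral>\<^sup>+s\<in>{norm x / 2..<2 * R}. J s \<partial>lborel)"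
    using Jm by (intro nn_integral_add) auto
  also have "\<dots> \<le> ennreal (C1 * (norm x powr (- a) * T powr (p x / q x))) + ennreal (CF * norm x powr (- a - \<beta>))"
    by (intro add_mono near far)
  also have "\<dots> = ennreal (C1 * (norm x powr (- a) * T powr (p x / q x)) + CF * norm x powr (- a - \<beta>))"
    by (rule ennreal_plus[symmetric]) (use C1 CF_nonneg in auto)
  finally have "W * \<bar>f x\<bar> \<le> C1 * (norm x powr (- a) * T powr (p x / q x)) + CF * norm x powr (- a - \<beta>)"
    using C1 CF_nonneg by (subst (asm) ennreal_le_iff) auto
  then have "norm x powr a * (W * \<bar>f x\<bar>) \<le> norm x powr a * (C1 * (norm x powr (- a) * T powr (p x / q x)) + CF * norm x powr (- a - \<beta>))"
    by (intro mult_left_mono) auto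
  also have "\<dots> = C1 * T powr (p x / q x) + CF * norm x powr (- \<beta>)"
  proof -
    have "norm x powr a * norm x powr (- a) = 1" "norm x powr a * norm x powr (- a - \<beta>) = norm x powr (- \<beta>)"
      using x by (simp_all add: powr_add[symmetric])
    then show ?thesis by algebra
  qed
  also have "\<dots> \<le> (C1 + CF) * (T powr (p x / q x) + norm x powr (- \<beta>))"
    using C1 CF_nonneg by (simp add: algebra_simps)
  finally have "W * (norm x powr a * \<bar>f x\<bar>) \<le> (C1 + CF) * (T powr (p x / q x) + norm x powr (- \<beta>))"
    by (simp add: mult_ac)
  then show ?thesis using W_pos unfolding C1_def[symmetric] times_divide_eq_left
    by (simp only: pos_le_divide_eq mult.commute[of _ W])
qed


definition "CP = CA + CB"
text \<open>The summand 1 gives \<open>CD \<ge> 1\<close>, so that powers with exponent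
  \<open>q x\<close> are dominated by those with exponent \<open>Q\<close>.\<close>

definition "CD = 1 + (2 powr \<bar>b\<bar> * CP * (1 + Q / \<nu>) + CF) / W"
definition "CE = (2 * CD) powr Q * (2 powr Q * (2 powr \<sigma> + K) + K powr N)"

lemma CB_pos: "0 < CB" using V_pos C0_ge by (simp add: CB_def add_pos_nonneg)

lemma CP_pos: "0 < CP" using CA_pos CB_pos by (simp add: CP_def)

lemma CD_ge: "1 \<le> CD"
proof -
  have "0 \<le> (2 powr \<bar>b\<bar> * CP * (1 + Q / \<nu>) + CF) / W"
    using CP_pos CF_nonneg W_pos Q_gt \<nu>_pos by (intro divide_nonneg_pos add_nonneg_nonneg mult_nonneg_nonneg) auto
  then show ?thesis by (simp add: CD_def)
qed

lemma CE_pos: "0 < CE"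
  using CD_ge K_ge unfolding CE_def by (intro mult_pos_pos add_pos_pos) auto

text \<open>Here \<tau> bounds only the averages of the truncation to
  \<open>ball x0 (2 * \<rho>)\<close>. For \<open>s \<le> \<rho>\<close> the ball around
  \<open>x\<close> stays inside and Diening's estimate applies; larger balls are left to the Morrey
  bound, at worst \<open>\<rho> powr (- (\<mu> x / p x))\<close>. Raising to the power
  \<open>q x\<close> turns \<open>T powr (p x / q x)\<close> into \<open>T powr p x\<close>, in
  which \<tau> acquires the constant exponent \<sigma>; log-Hoelder continuity moves the other
  exponents to \<open>x0\<close> and to 0.\<close>

lemma powr_norm_mult_le_of_average:
  assumes f: "C1_in f g" and G: "morrey_unit (\<lambda>y. norm y powr b * norm (g y))"
    and x: "x \<in> \<Omega>" "x \<noteq> 0" and x0: "x0 \<in> \<Omega>" "dist x0 x < \<rho>" "0 < \<rho>" "\<rho> \<le> R" and "0 \<le> \<tau>"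
    and avg: "\<And>r. 0 < r \<Longrightarrow> r \<le> 2 * R \<Longrightarrow>
      (\<integral>\<^sup>+y\<in>ball x r. ennreal ((norm y powr b * norm (g y)) powr (p y / \<sigma>) * indicator (ball x0 (2 * \<rho>)) y) \<partial>lborel)
        \<le> ennreal (\<tau> * r powr N)"
  shows "(norm x powr a * \<bar>f x\<bar>) powr q x \<le> CE * (\<tau> powr \<sigma> + 1 + \<rho> powr (- \<mu> x0) + norm x powr (- \<mu> 0))"
proof -
  let ?G = "\<lambda>y. norm y powr b * norm (g y)"
  define T where "T = (\<tau> + 1) powr (\<sigma> / p x) + \<rho> powr (- (\<mu> x / p x))"
  have T: "0 < T" using \<open>0 \<le> \<tau>\<close> by (simp add: T_def add_pos_nonneg)
  have T1: "(\<tau> + 1) powr (\<sigma> / p x) \<le> T" and T2: "\<rho> powr (- (\<mu> x / p x)) \<le> T"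
    by (simp_all add: T_def)
  have "norm x powr a * \<bar>f x\<bar> \<le>
    (2 powr \<bar>b\<bar> * CP * (1 + Q / \<nu>) + CF) / W * (T powr (p x / q x) + norm x powr (- \<beta>))"
  proof (rule norm_powr_mult_le[OF f G x T])
    show "CA \<le> CP" using CB_pos by (simp add: CP_def)
    fix s assume s: "0 < s" "s \<le> 2 * R"
    show "(\<integral>\<^sup>+y\<in>ball x s. ennreal (?G y) \<partial>lborel) \<le> ennreal (CP * T * s powr N)"
    proof (cases "s \<le> \<rho>")
      case True
      have sub: "ball x s \<subseteq> ball x0 (2 * \<rho>)"
      proof
        fix y assume "y \<in> ball x s"
        then have "dist x0 y < 2 * \<rho>" using dist_triangle[of x0 y x] x0 True by simp
        then show "y \<in> ball x0 (2 * \<rho>)" by simp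
      qed
      have "(\<integral>\<^sup>+y\<in>ball x s. ennreal (?G y powr (p y / \<sigma>)) \<partial>lborel)
        = (\<integral>\<^sup>+y\<in>ball x s. ennreal (?G y powr (p y / \<sigma>) * indicator (ball x0 (2 * \<rho>)) y) \<partial>lborel)"
        using sub by (intro nn_integral_cong) (auto simp: indicator_def)
      also have "\<dots> \<le> ennreal (\<tau> * s powr N)" by (rule avg[OF s])
      finally have "(\<integral>\<^sup>+y\<in>ball x s. ennreal (?G y) \<partial>lborel) \<le> ennreal (CB * s powr N * (\<tau> + 1) powr (\<sigma> / p x))"
        by (rule nn_integral_ball_le_of_average[OF G x(1) s \<open>0 \<le> \<tau>\<close>])
      also have "\<dots> \<le> ennreal (CP * s powr N * T)"
        using CA_pos CB_pos T1 by (intro ennreal_leI mult_mono) (auto simp: CP_def)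
      finally show ?thesis by (simp add: mult_ac)
    next
      case False
      have "(\<integral>\<^sup>+y\<in>ball x s. ennreal (?G y) \<partial>lborel) \<le> ennreal (CA * s powr (N - \<mu> x / p x))"
        using s by (intro nn_integral_ball_le[OF G x(1)]) auto
      also have "s powr (N - \<mu> x / p x) = s powr N * s powr (- (\<mu> x / p x))"
        by (simp add: powr_add[symmetric])
      also have "ennreal (CA * (s powr N * s powr (- (\<mu> x / p x)))) \<le> ennreal (CP * (s powr N * T))"
      proof (intro ennreal_leI mult_mono)
        have "s powr (- (\<mu> x / p x)) \<le> \<rho> powr (- (\<mu> x / p x))"
          using False x0 mu_pos[OF x(1)] p_gt[of x] by (intro powr_mono2') auto
        then show "s powr (- (\<mu> x / p x)) \<le> T" using T2 by linarith
      qed (use CA_pos CB_pos in \<open>auto simp: CP_def\<close>)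
      finally show ?thesis by (simp add: mult_ac)
    qed
  qed
  also have "\<dots> \<le> CD * (T powr (p x / q x) + norm x powr (- \<beta>))"
    by (intro mult_right_mono) (auto simp: CD_def)
  finally have le: "norm x powr a * \<bar>f x\<bar> \<le> CD * (T powr (p x / q x) + norm x powr (- \<beta>))" .
  have q0: "0 < q x" using q_gt[of x] by simp
  have "(norm x powr a * \<bar>f x\<bar>) powr q x \<le> (CD * (T powr (p x / q x) + norm x powr (- \<beta>))) powr q x"
    using le q0 by (intro powr_mono2) auto
  also have "\<dots> = CD powr q x * (T powr (p x / q x) + norm x powr (- \<beta>)) powr q x"
    using CD_ge by (simp add: powr_mult)
  also have "\<dots> \<le> CD powr q x * (2 powr q x * ((T powr (p x / q x)) powr q x + (norm x powr (- \<beta>)) powr q x))"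
    using q0 by (intro mult_left_mono add_powr_le) auto
  also have "\<dots> = (2 * CD) powr q x * (T powr p x + norm x powr (- \<beta> * q x))"
    using q0 CD_ge by (simp add: powr_mult powr_powr)
  also have "\<dots> \<le> (2 * CD) powr Q * (2 powr Q * (2 powr \<sigma> * (\<tau> powr \<sigma> + 1) + K * \<rho> powr (- \<mu> x0)) + K powr N * norm x powr (- \<mu> 0))"
  proof (intro mult_mono add_mono)
    show "(2 * CD) powr q x \<le> (2 * CD) powr Q" using CD_ge q_le[of x] by (intro powr_mono) auto
    have "T powr p x \<le> 2 powr p x * (((\<tau> + 1) powr (\<sigma> / p x)) powr p x + (\<rho> powr (- (\<mu> x / p x))) powr p x)"
      unfolding T_def using p_gt[of x] by (intro add_powr_le) auto
    also have "\<dots> = 2 powr p x * ((\<tau> + 1) powr \<sigma> + \<rho> powr (- \<mu> x))"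
      using p_gt[of x] by (simp add: powr_powr)
    also have "\<dots> \<le> 2 powr Q * (2 powr \<sigma> * (\<tau> powr \<sigma> + 1) + K * \<rho> powr (- \<mu> x0))"
    proof (intro mult_mono add_mono)
      show "2 powr p x \<le> (2::real) powr Q" using p_le[of x] by (intro powr_mono) auto
      show "(\<tau> + 1) powr \<sigma> \<le> 2 powr \<sigma> * (\<tau> powr \<sigma> + 1)"
        using add_powr_le[of \<tau> 1 \<sigma>] \<open>0 \<le> \<tau>\<close> \<sigma>_gt by simp
      have "\<rho> powr (- \<mu> x) = \<rho> powr (lam x - lam x0) * \<rho> powr (- \<mu> x0)"
        by (simp add: powr_add[symmetric])
      also have "\<dots> \<le> K * \<rho> powr (- \<mu> x0)"
        using x x0 R_ge by (intro mult_right_mono log_lam) (auto simp: dist_commute)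
      finally show "\<rho> powr (- \<mu> x) \<le> K * \<rho> powr (- \<mu> x0)" .
    qed auto
    finally show "T powr p x \<le> 2 powr Q * (2 powr \<sigma> * (\<tau> powr \<sigma> + 1) + K * \<rho> powr (- \<mu> x0))" .
    \<comment> \<open>The exponents \<open>\<mu> 0 * q x / q 0\<close> and \<open>\<mu> 0\<close>
      differ by a multiple of \<open>q x - q 0\<close>, harmless at the scale \<open>norm x\<close>,
      which is the distance from \<open>x\<close> to the origin.\<close>
    have "norm x powr (- \<beta> * q x) = (norm x powr (q 0 - q x)) powr \<beta> * norm x powr (- \<mu> 0)"
    proof -
      have "- \<beta> * q x = (q 0 - q x) * \<beta> + (- \<mu> 0)"
        using q_gt[of 0] by (simp add: divide_simps) (simp add: algebra_simps)
      then show ?thesis by (simp only: powr_powr powr_add[symmetric])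
    qed
    also have "\<dots> \<le> K powr N * norm x powr (- \<mu> 0)"
    proof (intro mult_right_mono K_powr_le)
      show "0 \<le> \<beta>" using mu_pos[OF zero_in] q_gt[of 0] by simp
      show "\<beta> \<le> N" by (rule mu_p_le[OF zero_in])
      show "norm x powr (q 0 - q x) \<le> K"
        using x zero_in norm_less[OF x(1)] R_ge by (intro log_q) auto
    qed auto
    finally show "norm x powr (- \<beta> * q x) \<le> K powr N * norm x powr (- \<mu> 0)" .
  qed (use K_ge in auto)
  also have "\<dots> \<le> CE * (\<tau> powr \<sigma> + 1 + \<rho> powr (- \<mu> x0) + norm x powr (- \<mu> 0))"
  proof -
    define A B C D where "A = \<tau> powr \<sigma> + 1" "B = \<rho> powr (- \<mu> x0)" "C = norm x powr (- \<mu> 0)" "D = (2::real) powr Q"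
    have nn: "0 \<le> A" "0 \<le> B" "0 \<le> C" "0 \<le> D" by (simp_all add: A_B_C_D_def)
    have "D * (2 powr \<sigma> * A + K * B) + K powr N * C \<le> (D * (2 powr \<sigma> + K) + K powr N) * (A + B + C)"
    proof -
      have "(D * (2 powr \<sigma> + K) + K powr N) * (A + B + C) - (D * (2 powr \<sigma> * A + K * B) + K powr N * C)
         = D * (2 powr \<sigma>) * (B + C) + D * K * (A + C) + K powr N * (A + B)" by algebra
      also have "\<dots> \<ge> 0" using nn K_ge by auto
      finally show ?thesis by simp
    qed
    then show ?thesis unfolding CE_def A_B_C_D_def[symmetric] mult.assoc by (intro mult_left_mono) auto
  qed
  finally show ?thesis .
qed

section \<open>The singular power \<open>norm x powr (- \<mu> 0)\<close> on balls\<close>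

definition "CR = 2 powr N * K * V + 2 powr N / (1 - 2 powr (\<mu> 0 - N)) * V * 3 powr N * K"

lemma two_powr_less_1: "(2::real) powr (\<mu> 0 - N) < 1"
proof -
  have "(2::real) powr (\<mu> 0 - N) < 2 powr 0" using lam_pos[OF zero_in] by (intro powr_less_mono) auto
  then show ?thesis by simp
qed

lemma CR_pos: "0 < CR"
  unfolding CR_def using two_powr_less_1 V_pos K_ge
  by (intro add_pos_nonneg mult_nonneg_nonneg divide_nonneg_pos mult_pos_pos) auto

text \<open>If \<open>norm x0 < 2 * r\<close>, the ball lies in \<open>ball 0 (3 * r)\<close>, where
  integration gives \<open>r powr lam 0\<close> up to a constant, and the exponent is moved to
  \<open>lam x0\<close> at scale \<open>r\<close>. Otherwise \<open>norm x \<ge> norm x0 / 2\<close>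
  on the ball; the exponent is moved to \<open>\<mu> x0\<close> at scale \<open>norm x0\<close>, and
  only then is \<open>norm x0\<close> replaced by the smaller \<open>r\<close>.\<close>

lemma nn_integral_ball_norm_powr_le:
  assumes x0: "x0 \<in> \<Omega>" and r: "0 < r" "r \<le> R"
  shows "(\<integral>\<^sup>+x\<in>ball x0 r. ennreal (norm x powr (- \<mu> 0)) \<partial>lborel) \<le> ennreal (CR * r powr lam x0)"
proof (cases "norm x0 < 2 * r")
  case True
  have "(\<integral>\<^sup>+x\<in>ball x0 r. ennreal (norm x powr (- \<mu> 0)) \<partial>lborel) \<le> (\<integral>\<^sup>+x\<in>ball (0::'a) (3 * r). ennreal (norm x powr (- \<mu> 0)) * 1 \<partial>lborel)"
  proof (rule nn_integral_mono)
    fix x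
    have "x \<in> ball (0::'a) (3 * r)" if "x \<in> ball x0 r"
      using that True dist_triangle[of 0 x x0] by simp
    then show "ennreal (norm x powr (- \<mu> 0)) * indicator (ball x0 r) x \<le> ennreal (norm x powr (- \<mu> 0)) * 1 * indicator (ball (0::'a) (3 * r)) x"
      by (auto simp: indicator_def)
  qed
  also have "\<dots> \<le> ennreal (2 powr \<bar>\<mu> 0\<bar> / (1 - 2 powr (\<mu> 0 - N)) * V * (3 * r) powr (N - \<mu> 0))"
    using r V_pos lam_pos[OF zero_in]
    by (intro nn_integral_norm_powr_ball) (auto simp: emeasure_ball_N)
  also have "\<dots> \<le> ennreal (2 powr N / (1 - 2 powr (\<mu> 0 - N)) * V * (3 powr N * (K * r powr lam x0)))"
  proof (intro ennreal_leI mult_mono divide_right_mono)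
    show "2 powr \<bar>\<mu> 0\<bar> \<le> (2::real) powr N" using mu_pos[OF zero_in] mu_le[OF zero_in] by (intro powr_mono) auto
    have "(3 * r) powr (N - \<mu> 0) = 3 powr lam 0 * r powr lam 0" using r by (simp add: powr_mult)
    also have "r powr lam 0 = r powr (lam 0 - lam x0) * r powr lam x0" by (simp add: powr_add[symmetric])
    also have "3 powr lam 0 * (r powr (lam 0 - lam x0) * r powr lam x0) \<le> 3 powr N * (K * r powr lam x0)"
    proof (rule mult_mono)
      show "3 powr lam 0 \<le> (3::real) powr N" using lam_less[OF zero_in] by (intro powr_mono) auto
      show "r powr (lam 0 - lam x0) * r powr lam x0 \<le> K * r powr lam x0"
        using r R_ge x0 zero_in True by (intro mult_right_mono log_lam) auto
    qed (use K_ge in auto)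
    finally show "(3 * r) powr (N - \<mu> 0) \<le> 3 powr N * (K * r powr lam x0)" .
  qed (use two_powr_less_1 V_pos K_ge in auto)
  also have "\<dots> \<le> ennreal (CR * r powr lam x0)"
    using V_pos K_ge by (intro ennreal_leI) (simp add: CR_def algebra_simps)
  finally show ?thesis .
next
  case False
  have "norm x powr (- \<mu> 0) \<le> 2 powr N * (K * r powr (- \<mu> x0))" if "x \<in> ball x0 r" for x
  proof -
    have x0': "0 < norm x0" "r \<le> norm x0" using False r by auto
    have "norm x0 / 2 \<le> norm x"
      using that False norm_triangle_ineq2[of x0 x] by (simp add: dist_norm)
    then have "norm x powr (- \<mu> 0) \<le> (norm x0 / 2) powr (- \<mu> 0)"
      using x0' mu_pos[OF zero_in] by (intro powr_mono2') auto
    also have "\<dots> = 2 powr \<mu> 0 * (norm x0 powr (lam 0 - lam x0) * norm x0 powr (- \<mu> x0))"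
      using x0' by (simp add: powr_divide powr_minus powr_add[symmetric]) (simp add: powr_diff field_simps)
    also have "\<dots> \<le> 2 powr N * (K * r powr (- \<mu> x0))"
    proof (intro mult_mono)
      show "2 powr \<mu> 0 \<le> (2::real) powr N" using mu_le[OF zero_in] by (intro powr_mono) auto
      show "norm x0 powr (lam 0 - lam x0) \<le> K"
        using x0' norm_less[OF x0] R_ge zero_in x0 by (intro log_lam) auto
      show "norm x0 powr (- \<mu> x0) \<le> r powr (- \<mu> x0)"
        using x0' r mu_pos[OF x0] by (intro powr_mono2') auto
    qed (use K_ge in auto)
    finally show ?thesis .
  qed
  then have "(\<integral>\<^sup>+x\<in>ball x0 r. ennreal (norm x powr (- \<mu> 0)) \<partial>lborel)
     \<le> (\<integral>\<^sup>+x. ennreal (2 powr N * (K * r powr (- \<mu> x0))) * indicator (ball x0 r) x \<partial>lborel)"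
    by (intro nn_integral_mono) (auto simp: indicator_def intro!: ennreal_leI)
  also have "\<dots> = ennreal (2 powr N * (K * r powr (- \<mu> x0))) * ennreal (V * r powr N)"
    using r by (simp add: nn_integral_cmult_indicator emeasure_ball_N)
  also have "\<dots> = ennreal (2 powr N * (K * r powr (- \<mu> x0)) * (V * r powr N))"
    using K_ge V_pos by (intro ennreal_mult[symmetric]) auto
  also have "2 powr N * (K * r powr (- \<mu> x0)) * (V * r powr N) = 2 powr N * K * V * r powr lam x0"
  proof -
    have "r powr (- \<mu> x0) * r powr N = r powr lam x0" by (simp add: powr_add[symmetric])
    moreover have "2 powr N * (K * r powr (- \<mu> x0)) * (V * r powr N) = 2 powr N * K * V * (r powr (- \<mu> x0) * r powr N)"
      by (simp only: mult_ac)
    ultimately show ?thesis by (simp only:)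
  qed
  also have "ennreal \<dots> \<le> ennreal (CR * r powr lam x0)"
    using two_powr_less_1 V_pos K_ge by (intro ennreal_leI mult_right_mono) (auto simp: CR_def)
  finally show ?thesis .
qed

end

subsection \<open>The Morrey estimate\<close>

context morrey_data
begin

definition "CM = \<sigma> * (2 * 5 powr N * V) * (2 * V) powr (\<sigma> - 1) / (\<sigma> - 1)"
definition "CT = CE * (CM * 2 powr N + V * (R powr N + 1) + CR)"

lemma CM_eq: "CM = \<sigma> * (2 * 5 ^ DIM('a) * V) * (2 * V) powr (\<sigma> - 1) / (\<sigma> - 1)"
  unfolding CM_def by (simp add: N_eq powr_realpow)

lemma CM_nonneg: "0 \<le> CM"
  using \<sigma>_gt V_pos by (simp add: CM_def)

lemma CT_pos: "0 < CT"
  unfolding CT_def using CE_pos CM_nonneg V_pos CR_pos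
  by (intro mult_pos_pos add_nonneg_pos add_nonneg_nonneg mult_nonneg_nonneg) auto

lemma morrey_estimate_small_ball:
  assumes f: "C1_in f g" and G: "morrey_unit (\<lambda>y. norm y powr b * norm (g y))"
    and x0: "x0 \<in> \<Omega>" and r: "0 < r" "r \<le> R"
  shows "(\<integral>\<^sup>+x\<in>ball x0 r. ennreal ((norm x powr a * \<bar>f x\<bar>) powr q x) \<partial>lborel) \<le> ennreal (CT * r powr lam x0)"
proof -
  let ?G = "\<lambda>y. norm y powr b * norm (g y)"
  note [measurable] = morrey_unitD(1)[OF G]
  have [measurable]: "ball x0 r \<in> sets borel" "ball x0 (2 * r) \<in> sets borel" by simp_all
  have "continuous_on UNIV f"
    using f unfolding C1_in_def gderiv_def
    by (auto intro!: has_derivative_continuous_on[of UNIV f "\<lambda>z h. h \<bullet> g z"])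
  then have fm[measurable]: "f \<in> borel_measurable borel" by (rule borel_measurable_continuous_onI)
  define \<Phi> where "\<Phi> x = (norm x powr a * \<bar>f x\<bar>) powr q x" for x
  have [measurable]: "\<Phi> \<in> borel_measurable borel" unfolding \<Phi>_def by measurable
  have \<Phi>_out: "\<Phi> x = 0" if "x \<notin> \<Omega>" for x using f that by (simp add: \<Phi>_def C1_in_def)
  define E where "E x = 1 + r powr (- \<mu> x0) + norm x powr (- \<mu> 0)" for x :: 'a
  have E: "0 \<le> E x" for x by (simp add: E_def add_nonneg_nonneg)
  have [measurable]: "E \<in> borel_measurable borel" unfolding E_def by measurable
  \<comment> \<open>The pointwise estimate solved for \<tau>. If all averages of \<open>h\<close> at
    \<open>x\<close> were at most some \<open>t < m x\<close>, that estimate with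
    \<open>\<tau> = t\<close> would give \<open>\<Phi> x / CE \<le> t powr \<sigma> + E x\<close>,
    that is \<open>m x \<le> t\<close>. Thus \<open>m\<close> is an explicit Borel function below
    the maximal function of \<open>h\<close>.\<close>
  define m where "m x = (if x \<noteq> 0 \<and> dist x0 x < r then max 0 (\<Phi> x / CE - E x) powr (1 / \<sigma>) else 0)" for x
  \<comment> \<open>Its power \<sigma> is \<open>?G y powr p y\<close> on the doubled ball, whose
    integral the Morrey condition bounds by \<open>(2 * r) powr lam x0\<close>.\<close>
  define h where "h y = ?G y powr (p y / \<sigma>) * indicator (ball x0 (2 * r)) y" for y
  have hm: "h \<in> borel_measurable borel" unfolding h_def by measurable
  have mm[measurable]: "m \<in> borel_measurable borel" unfolding m_def by measurable
  have "(\<integral>\<^sup>+x. ennreal (m x powr \<sigma>) \<partial>lborel) \<le> ennreal CM * (\<integral>\<^sup>+y. ennreal (h y powr \<sigma>) \<partial>lborel)"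
    unfolding CM_eq unfolding N_eq
  proof (rule maximal_strong_type[OF hm _ mm _ \<sigma>_gt])
    fix x t assume t: "0 < t" "t < m x"
    have x: "x \<noteq> 0" "dist x0 x < r" and tm: "t < max 0 (\<Phi> x / CE - E x) powr (1 / \<sigma>)"
      using t by (auto simp: m_def split: if_splits)
    have pos: "0 < \<Phi> x / CE - E x"
    proof (rule ccontr)
      assume "\<not> ?thesis"
      then have "max 0 (\<Phi> x / CE - E x) = 0" by simp
      with tm t show False by simp
    qed
    have x\<Omega>: "x \<in> \<Omega>"
      using pos \<Phi>_out[of x] E[of x] by (cases "x \<in> \<Omega>") auto
    show "\<exists>s>0. s \<le> 2 * R \<and> ennreal (t * s ^ DIM('a)) < (\<integral>\<^sup>+y\<in>ball x s. ennreal (h y) \<partial>lborel)"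
    proof (rule ccontr)
      assume no: "\<not> ?thesis"
      have "\<Phi> x \<le> CE * (t powr \<sigma> + 1 + r powr (- \<mu> x0) + norm x powr (- \<mu> 0))"
        unfolding \<Phi>_def
      proof (rule powr_norm_mult_le_of_average[OF f G x\<Omega> x(1) x0 x(2) r])
        fix s assume s: "0 < s" "s \<le> 2 * R"
        then have "\<not> ennreal (t * s ^ DIM('a)) < (\<integral>\<^sup>+y\<in>ball x s. ennreal (h y) \<partial>lborel)"
          using no by blast
        then have "(\<integral>\<^sup>+y\<in>ball x s. ennreal (h y) \<partial>lborel) \<le> ennreal (t * s powr N)"
          using s by (simp add: N_eq powr_realpow not_less)
        then show "(\<integral>\<^sup>+y\<in>ball x s. ennreal (?G y powr (p y / \<sigma>) * indicator (ball x0 (2 * r)) y) \<partial>lborel) \<le> ennreal (t * s powr N)"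
          unfolding h_def .
      qed (use t in auto)
      then have "\<Phi> x / CE \<le> t powr \<sigma> + E x"
        using CE_pos by (simp add: pos_divide_le_eq E_def add_ac mult.commute)
      then have "max 0 (\<Phi> x / CE - E x) powr (1 / \<sigma>) \<le> (t powr \<sigma>) powr (1 / \<sigma>)"
        using \<sigma>_gt by (intro powr_mono2) auto
      also have "\<dots> = t" using t \<sigma>_gt by (simp add: powr_powr)
      finally show False using tm by simp
    qed
  qed (auto simp: h_def m_def)
  also have "(\<integral>\<^sup>+y. ennreal (h y powr \<sigma>) \<partial>lborel) = (\<integral>\<^sup>+y\<in>ball x0 (2 * r). ennreal (?G y powr p y) \<partial>lborel)"
    using \<sigma>_gt by (intro nn_integral_cong) (auto simp: h_def indicator_def powr_powr)
  also have "\<dots> \<le> ennreal ((2 * r) powr lam x0)"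
    using r by (intro morrey_unitD(4)[OF G x0]) auto
  finally have m_le: "(\<integral>\<^sup>+x. ennreal (m x powr \<sigma>) \<partial>lborel) \<le> ennreal (CM * (2 * r) powr lam x0)"
    using CM_nonneg by (simp add: ennreal_mult mult_left_mono)
  have "(\<integral>\<^sup>+x\<in>ball x0 r. ennreal (\<Phi> x) \<partial>lborel) \<le> (\<integral>\<^sup>+x. ennreal CE * (ennreal (m x powr \<sigma>)
      + (ennreal (1 + r powr (- \<mu> x0)) * indicator (ball x0 r) x + ennreal (norm x powr (- \<mu> 0)) * indicator (ball x0 r) x)) \<partial>lborel)"
  proof (rule nn_integral_mono_AE)
    show "AE x in lborel. ennreal (\<Phi> x) * indicator (ball x0 r) x \<le> ennreal CE * (ennreal (m x powr \<sigma>)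
      + (ennreal (1 + r powr (- \<mu> x0)) * indicator (ball x0 r) x + ennreal (norm x powr (- \<mu> 0)) * indicator (ball x0 r) x))"
      using AE_lborel_singleton[of "0::'a"]
    proof eventually_elim
      case (elim x)
      show ?case
      proof (cases "x \<in> ball x0 r")
        case True
        have "m x powr \<sigma> = max 0 (\<Phi> x / CE - E x)"
          using elim True \<sigma>_gt by (simp add: m_def powr_powr)
        then have "\<Phi> x / CE \<le> m x powr \<sigma> + (1 + r powr (- \<mu> x0) + norm x powr (- \<mu> 0))"
          by (simp add: E_def)
        then have "\<Phi> x \<le> CE * (m x powr \<sigma> + (1 + r powr (- \<mu> x0) + norm x powr (- \<mu> 0)))"
          using CE_pos by (simp add: pos_divide_le_eq mult.commute)
        then have "ennreal (\<Phi> x) \<le> ennreal (CE * (m x powr \<sigma> + (1 + r powr (- \<mu> x0) + norm x powr (- \<mu> 0))))"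
          by (rule ennreal_leI)
        also have "\<dots> = ennreal CE * (ennreal (m x powr \<sigma>) + (ennreal (1 + r powr (- \<mu> x0)) + ennreal (norm x powr (- \<mu> 0))))"
        proof -
          have "0 \<le> 1 + r powr (- \<mu> x0)" by (simp add: add_nonneg_nonneg)
          then show ?thesis using CE_pos by (simp add: ennreal_mult ennreal_plus del: ennreal_1)
        qed
        finally show ?thesis using True by simp
      qed simp
    qed
  qed
  also have "\<dots> = ennreal CE * ((\<integral>\<^sup>+x. ennreal (m x powr \<sigma>) \<partial>lborel)
      + (ennreal (1 + r powr (- \<mu> x0)) * emeasure lborel (ball x0 r)
        + (\<integral>\<^sup>+x\<in>ball x0 r. ennreal (norm x powr (- \<mu> 0)) \<partial>lborel)))"
    by (subst nn_integral_cmult, measurable, subst nn_integral_add, measurable, subst nn_integral_add, measurable)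
       (simp add: nn_integral_cmult_indicator)
  also have "\<dots> \<le> ennreal CE * (ennreal (CM * (2 * r) powr lam x0)
      + (ennreal (1 + r powr (- \<mu> x0)) * ennreal (V * r powr N) + ennreal (CR * r powr lam x0)))"
    using r by (intro mult_left_mono add_mono m_le nn_integral_ball_norm_powr_le[OF x0]) (auto simp: emeasure_ball_N)
  also have "\<dots> = ennreal (CE * (CM * (2 * r) powr lam x0 + ((1 + r powr (- \<mu> x0)) * (V * r powr N) + CR * r powr lam x0)))"
  proof -
    have "0 \<le> 1 + r powr (- \<mu> x0)" by (simp add: add_nonneg_nonneg)
    then show ?thesis using CE_pos CM_nonneg CR_pos V_pos
      by (subst ennreal_mult[symmetric], simp, simp, subst ennreal_plus[symmetric], simp, simp,
          subst ennreal_plus[symmetric], simp, simp, subst ennreal_mult[symmetric]) auto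
  qed
  also have "\<dots> \<le> ennreal (CT * r powr lam x0)"
  proof (rule ennreal_leI)
    have 1: "(2 * r) powr lam x0 \<le> 2 powr N * r powr lam x0"
    proof -
      have "2 powr lam x0 \<le> (2::real) powr N" using lam_less[OF x0] by (intro powr_mono) auto
      then have "2 powr lam x0 * r powr lam x0 \<le> 2 powr N * r powr lam x0" by (intro mult_right_mono) auto
      then show ?thesis using r by (simp add: powr_mult)
    qed
    \<comment> \<open>The summand 1 of Diening's estimate costs the volume of the ball; for radii at
      most \<open>R\<close> this is dominated by \<open>r powr lam x0\<close>.\<close>
    have "r powr N = r powr \<mu> x0 * r powr lam x0" by (simp add: powr_add[symmetric])
    also have "\<dots> \<le> R powr N * r powr lam x0"
    proof (rule mult_right_mono)
      have "r powr \<mu> x0 \<le> R powr \<mu> x0" using r mu_pos[OF x0] by (intro powr_mono2) auto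
      also have "\<dots> \<le> R powr N" using R_ge mu_le[OF x0] by (intro powr_mono) auto
      finally show "r powr \<mu> x0 \<le> R powr N" .
    qed simp
    finally have "r powr N \<le> R powr N * r powr lam x0" .
    moreover have "r powr (- \<mu> x0) * r powr N = r powr lam x0" by (simp add: powr_add[symmetric])
    ultimately have 2: "(1 + r powr (- \<mu> x0)) * r powr N \<le> (R powr N + 1) * r powr lam x0"
      by (simp add: algebra_simps)
    have "CM * (2 * r) powr lam x0 \<le> CM * (2 powr N * r powr lam x0)"
      using 1 CM_nonneg by (rule mult_left_mono)
    moreover have "V * ((1 + r powr (- \<mu> x0)) * r powr N) \<le> V * ((R powr N + 1) * r powr lam x0)"
      using 2 V_pos by (intro mult_left_mono) auto
    ultimately have "CM * (2 * r) powr lam x0 + ((1 + r powr (- \<mu> x0)) * (V * r powr N) + CR * r powr lam x0)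
       \<le> (CM * 2 powr N + V * (R powr N + 1) + CR) * r powr lam x0"
      by (simp add: algebra_simps)
    then show "CE * (CM * (2 * r) powr lam x0 + ((1 + r powr (- \<mu> x0)) * (V * r powr N) + CR * r powr lam x0)) \<le> CT * r powr lam x0"
      using CE_pos by (simp add: CT_def mult.assoc)
  qed
  finally show ?thesis by (simp add: \<Phi>_def)
qed

text \<open>Any two points of \<Omega> are less than \<open>R\<close> apart, so a ball of radius
  above \<open>R\<close> sees no more of \<Omega> than the one of radius \<open>R\<close>, while the
  right-hand side grows with \<open>r\<close>.\<close>

lemma morrey_estimate:
  assumes f: "C1_in f g" and G: "morrey_unit (\<lambda>y. norm y powr b * norm (g y))"
    and x0: "x0 \<in> \<Omega>" and r: "0 < r"
  shows "(\<integral>\<^sup>+x\<in>ball x0 r. ennreal ((norm x powr a * \<bar>f x\<bar>) powr q x) \<partial>lborel) \<le> ennreal (CT * r powr lam x0)"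
proof (cases "r \<le> R")
  case True
  then show ?thesis using assms by (intro morrey_estimate_small_ball)
next
  case False
  have "(\<integral>\<^sup>+x\<in>ball x0 r. ennreal ((norm x powr a * \<bar>f x\<bar>) powr q x) \<partial>lborel)
      \<le> (\<integral>\<^sup>+x\<in>ball x0 R. ennreal ((norm x powr a * \<bar>f x\<bar>) powr q x) \<partial>lborel)"
  proof (rule nn_integral_mono)
    fix x
    show "ennreal ((norm x powr a * \<bar>f x\<bar>) powr q x) * indicator (ball x0 r) x
      \<le> ennreal ((norm x powr a * \<bar>f x\<bar>) powr q x) * indicator (ball x0 R) x"
    proof (cases "x \<in> \<Omega>")
      case True
      have "dist x0 x \<le> norm x0 + norm x" by (simp add: dist_norm norm_triangle_ineq4)
      then have "x \<in> ball x0 R" using norm_less[OF x0] norm_less[OF True] by simp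
      then show ?thesis by (simp add: indicator_def)
    next
      case False
      then show ?thesis using f by (simp add: C1_in_def)
    qed
  qed
  also have "\<dots> \<le> ennreal (CT * R powr lam x0)"
    using R_ge by (intro morrey_estimate_small_ball[OF f G x0]) auto
  also have "\<dots> \<le> ennreal (CT * r powr lam x0)"
    using False R_ge CT_pos lam_pos[OF x0] by (intro ennreal_leI mult_left_mono powr_mono2) auto
  finally show ?thesis .
qed

end

subsection \<open>Log-Hoelder exponents and functions of class \<open>C\<^sup>1\<^sub>c\<close>\<close>

text \<open>The modulus of continuity tends to 0 with the distance. Continuity turns the essential
  bounds on the exponents into pointwise ones and makes their extensions Borel.\<close>

lemma LH0_continuous_on:
  assumes "u \<in> LH0 \<Omega>"
  shows "continuous_on \<Omega> u"
proof -
  obtain C where C: "\<And>x y. x \<in> \<Omega> \<Longrightarrow> y \<in> \<Omega> \<Longrightarrow> dist x y < 1/2 \<Longrightarrow> \<bar>u x - u y\<bar> \<le> C / (- ln (dist x y))"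
    using assms unfolding LH0_def by blast
  show ?thesis
    unfolding continuous_on_iff
  proof (intro ballI allI impI)
    fix x and e :: real assume x: "x \<in> \<Omega>" and e: "0 < e"
    define d where "d = min (1/2) (exp (- (\<bar>C\<bar> / e)))"
    have "dist (u y) (u x) < e" if y: "y \<in> \<Omega>" "dist y x < d" for y
    proof (cases "y = x")
      case False
      then have D: "0 < dist x y" "dist x y < 1/2" "dist x y < exp (- (\<bar>C\<bar> / e))"
        using y by (auto simp: d_def dist_commute)
      then have "ln (dist x y) < - (\<bar>C\<bar> / e)" by (metis exp_gt_zero ln_exp ln_less_cancel_iff)
      then have L: "\<bar>C\<bar> / e < - ln (dist x y)" by simp
      moreover have "0 \<le> \<bar>C\<bar> / e" using e by simp
      ultimately have pos: "0 < - ln (dist x y)" by linarith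
      have "\<bar>u x - u y\<bar> \<le> C / (- ln (dist x y))" using C x y(1) D(2) by blast
      also have "\<dots> \<le> \<bar>C\<bar> / (- ln (dist x y))" using pos by (intro divide_right_mono) auto
      also have "\<dots> < e" using L pos e by (subst pos_divide_less_eq[OF pos]) (simp add: pos_divide_less_eq mult.commute)
      finally show ?thesis by (simp add: dist_real_def abs_minus_commute)
    qed (use e in simp)
    moreover have "0 < d" by (simp add: d_def)
    ultimately show "\<exists>d>0. \<forall>y\<in>\<Omega>. dist y x < d \<longrightarrow> dist (u y) (u x) < e" by blast
  qed
qed

text \<open>For \<open>r < 1/4\<close> one has \<open>2 * r \<le> sqrt r\<close>, so
  \<open>- ln (dist x y)\<close> is at least half of \<open>- ln r\<close>, and the product of
  \<open>\<bar>u x - u y\<bar>\<close> with \<open>\<bar>ln r\<bar>\<close> is at most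
  \<open>2 * \<bar>C\<bar>\<close>. For \<open>1/4 \<le> r \<le> B\<close> both factors are
  bounded.\<close>

lemma LH0_powr_le:
  fixes \<Omega> :: "'a::euclidean_space set"
  assumes "u \<in> LH0 \<Omega>" and U: "\<And>x. x \<in> \<Omega> \<Longrightarrow> \<bar>u x\<bar> \<le> U" and "1 \<le> B"
  shows "\<exists>K\<ge>1. \<forall>x\<in>\<Omega>. \<forall>y\<in>\<Omega>. \<forall>r>0. r \<le> B \<longrightarrow> dist x y \<le> 2 * r \<longrightarrow> r powr (u x - u y) \<le> K"
proof -
  obtain C where C: "\<And>x y. x \<in> \<Omega> \<Longrightarrow> y \<in> \<Omega> \<Longrightarrow> dist x y < 1/2 \<Longrightarrow> \<bar>u x - u y\<bar> \<le> C / (- ln (dist x y))"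
    using assms unfolding LH0_def by blast
  define L where "L = max (ln 4) (ln B)"
  define E where "E = max (2 * \<bar>C\<bar>) (2 * \<bar>U\<bar> * L)"
  have key: "\<bar>(u x - u y) * ln r\<bar> \<le> E" if xy: "x \<in> \<Omega>" "y \<in> \<Omega>" and r: "0 < r" "r \<le> B" and d: "dist x y \<le> 2 * r" for x y r
  proof (cases "r < 1/4")
    case False
    have "\<bar>ln r\<bar> \<le> L"
    proof -
      have "ln (1/4) \<le> ln r" using False by (subst ln_le_cancel_iff) auto
      then have "- ln 4 \<le> ln r" by (simp add: ln_div)
      moreover have "ln r \<le> ln B" using r \<open>1 \<le> B\<close> by simp
      ultimately show ?thesis unfolding L_def by linarith
    qed
    moreover have "\<bar>u x - u y\<bar> \<le> 2 * \<bar>U\<bar>" using U[OF xy(1)] U[OF xy(2)] by linarith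
    ultimately have "\<bar>u x - u y\<bar> * \<bar>ln r\<bar> \<le> 2 * \<bar>U\<bar> * L" by (intro mult_mono) auto
    then show ?thesis by (simp add: E_def abs_mult)
  next
    case True
    show ?thesis
    proof (cases "x = y")
      case True
      then show ?thesis by (simp add: E_def le_max_iff_disj)
    next
      case False
      have r0: "ln r < 0" using r \<open>r < 1/4\<close> by simp
      have d0: "0 < dist x y" "dist x y < 1/2" using False d \<open>r < 1/4\<close> by auto
      have "ln r \<le> ln (1/4)" using r \<open>r < 1/4\<close> by (subst ln_le_cancel_iff) auto
      also have "ln (1/4) = - 2 * ln (2::real)"
        using ln_realpow[of 2 2] by (simp add: ln_div)
      finally have l2: "ln r \<le> - 2 * ln 2" .
      have "ln (dist x y) \<le> ln (2 * r)" using d0 d r by (subst ln_le_cancel_iff) auto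
      also have "\<dots> = ln 2 + ln r" using r by (simp add: ln_mult)
      finally have ld: "- ln r / 2 \<le> - ln (dist x y)" using l2 by simp
      have "\<bar>u x - u y\<bar> \<le> C / (- ln (dist x y))" using C[OF xy d0(2)] .
      also have "\<dots> \<le> \<bar>C\<bar> / (- ln (dist x y))" using ld r0 by (intro divide_right_mono) auto
      also have "\<dots> \<le> \<bar>C\<bar> / (- ln r / 2)" using ld r0 by (intro divide_left_mono mult_pos_pos) auto
      finally have "\<bar>u x - u y\<bar> * (- ln r) \<le> \<bar>C\<bar> / (- ln r / 2) * (- ln r)"
        using r0 by (intro mult_right_mono) auto
      then have "\<bar>u x - u y\<bar> * \<bar>ln r\<bar> \<le> 2 * \<bar>C\<bar>"
        using r0 by (simp add: abs_if)
      then show ?thesis by (simp add: E_def abs_mult)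
    qed
  qed
  have "r powr (u x - u y) \<le> exp E" if "x \<in> \<Omega>" "y \<in> \<Omega>" "0 < r" "r \<le> B" "dist x y \<le> 2 * r" for x y r
    using key[OF that] that by (simp add: powr_def)
  moreover have "1 \<le> exp E" by (simp add: E_def le_max_iff_disj)
  ultimately show ?thesis by blast
qed

text \<open>The set where \<open>u > c\<close> is open, and a nonempty open set is not null.\<close>

lemma AE_le_imp_le_continuous_on:
  fixes u :: "'a::euclidean_space \<Rightarrow> real"
  assumes "open \<Omega>" "continuous_on \<Omega> u" and AE: "AE x in lebesgue_on \<Omega>. u x \<le> c" and x: "x \<in> \<Omega>"
  shows "u x \<le> c"
proof (rule ccontr)
  assume "\<not> u x \<le> c"
  define S where "S = \<Omega> \<inter> u -` {c<..}"
  have "open S" unfolding S_def by (rule continuous_open_preimage) (use assms in auto)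
  moreover have "x \<in> S" using x \<open>\<not> u x \<le> c\<close> by (simp add: S_def)
  ultimately have "S \<notin> null_sets lebesgue"
    using open_not_negligible[of S] by (auto simp: negligible_iff_null_sets)
  moreover have "AE x in lebesgue. x \<in> \<Omega> \<longrightarrow> u x \<le> c"
    using AE assms(1) by (subst (asm) AE_restrict_space_iff) auto
  then have "AE y in lebesgue. y \<notin> S"
    by eventually_elim (auto simp: S_def)
  then have "S \<in> null_sets lebesgue" using \<open>open S\<close> by (subst AE_iff_null_sets) auto
  ultimately show False by blast
qed

section \<open>Gradients and extension by zero\<close>

lemma GDERIV_unique:
  assumes "GDERIV f x :> D" "GDERIV f x :> E"
  shows "D = E"
proof -
  have "(\<lambda>h. h \<bullet> D) = (\<lambda>h. h \<bullet> E)"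
    using assms unfolding gderiv_def by (rule has_derivative_unique)
  then show ?thesis by (metis inner_commute vector_eq_rdot)
qed

text \<open>A linear functional is represented by the vector of its values on the basis; together
  with uniqueness this justifies the definite description in \<open>gradient\<close>.\<close>

lemma GDERIV_gradient:
  assumes "f differentiable (at x)"
  shows "GDERIV f x :> gradient f x"
proof -
  obtain f' where f': "(f has_derivative f') (at x)" using assms unfolding differentiable_def by blast
  then interpret bounded_linear f' by (rule has_derivative_bounded_linear)
  define D where "D = (\<Sum>i\<in>Basis. f' i *\<^sub>R i)"
  have "f' h = h \<bullet> D" for h
  proof -
    have "f' h = f' (\<Sum>i\<in>Basis. (h \<bullet> i) *\<^sub>R i)" by (simp add: euclidean_representation)
    also have "\<dots> = (\<Sum>i\<in>Basis. (h \<bullet> i) * f' i)" by (simp add: sum scaleR)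
    also have "\<dots> = h \<bullet> D" by (simp add: D_def inner_sum_right mult.commute)
    finally show ?thesis .
  qed
  then have "f' = (\<lambda>h. h \<bullet> D)" by blast
  with f' have D: "GDERIV f x :> D" by (simp add: gderiv_def)
  show ?thesis
    unfolding gradient_def by (rule theI[of _ D]) (use D GDERIV_unique in blast)+
qed

text \<open>\<Omega> and the complement of the support are open and cover the space. Off the support
  the extension has gradient 0, and uniqueness identifies it with \<open>gradient f\<close> on the
  overlap, so continuity can be checked on the two sets separately.\<close>

lemma C1_compact_support_extend:
  fixes \<Omega> :: "'a::euclidean_space set"
  assumes f: "f \<in> C1_compact_support \<Omega>" and "open \<Omega>"
  defines "f0 \<equiv> \<lambda>x. if x \<in> \<Omega> then f x else 0"
    and "g0 \<equiv> \<lambda>x. if x \<in> \<Omega> then gradient f x else 0"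
  shows "GDERIV f0 x :> g0 x" and "continuous_on UNIV g0"
proof -
  define S where "S = closure {x\<in>\<Omega>. f x \<noteq> 0}"
  have S: "S \<subseteq> \<Omega>" "open (- S)" using f by (auto simp: C1_compact_support_def S_def)
  have f0_S: "f0 z = 0" if "z \<notin> S" for z
    using that closure_subset[of "{x\<in>\<Omega>. f x \<noteq> 0}"] by (auto simp: f0_def S_def)
  have in_\<Omega>: "GDERIV f0 z :> gradient f z" if "z \<in> \<Omega>" for z
  proof -
    have "GDERIV f z :> gradient f z"
      using f that by (intro GDERIV_gradient) (auto simp: C1_compact_support_def)
    then show ?thesis
      unfolding gderiv_def
      by (rule has_derivative_transform_within_open[OF _ \<open>open \<Omega>\<close> that]) (simp add: f0_def)
  qed
  have out_S: "GDERIV f0 z :> 0" if "z \<notin> S" for z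
  proof -
    have "GDERIV (\<lambda>_. 0::real) z :> 0" by (rule GDERIV_const)
    then show ?thesis
      unfolding gderiv_def
      by (rule has_derivative_transform_within_open[OF _ S(2)]) (use that f0_S in auto)
  qed
  have g0_S: "g0 z = 0" if "z \<notin> S" for z
    using GDERIV_unique[OF in_\<Omega> out_S[OF that]] by (auto simp: g0_def)
  show "GDERIV f0 x :> g0 x"
    using in_\<Omega>[of x] out_S[of x] S(1) by (auto simp: g0_def)
  have "continuous_on (\<Omega> \<union> - S) g0"
  proof (rule continuous_on_open_Un[OF \<open>open \<Omega>\<close> S(2)])
    have "continuous_on \<Omega> (gradient f)" using f by (simp add: C1_compact_support_def)
    then show "continuous_on \<Omega> g0" by (rule continuous_on_eq) (simp add: g0_def)
    show "continuous_on (- S) g0"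
      by (rule continuous_on_eq[OF continuous_on_const[of _ 0]]) (simp add: g0_S)
  qed
  moreover have "\<Omega> \<union> - S = UNIV" using S(1) by blast
  ultimately show "continuous_on UNIV g0" by simp
qed

subsection \<open>The norm inequality\<close>

lemma morrey_modular_cong:
  assumes "\<And>y. y \<in> \<Omega> \<Longrightarrow> p y = p' y"
  shows "morrey_modular \<Omega> p lam F = morrey_modular \<Omega> p' lam F"
proof -
  have "(\<integral>\<^sup>+y\<in>{y \<in> \<Omega>. dist x y < r}. ennreal (norm (F y) powr p y) \<partial>lebesgue)
    = (\<integral>\<^sup>+y\<in>{y \<in> \<Omega>. dist x y < r}. ennreal (norm (F y) powr p' y) \<partial>lebesgue)" for x r
    using assms by (intro nn_integral_cong) (auto simp: indicator_def)
  then show ?thesis by (simp add: morrey_modular_def)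
qed

lemma morrey_norm_cong:
  assumes "\<And>y. y \<in> \<Omega> \<Longrightarrow> p y = p' y"
  shows "morrey_norm \<Omega> p lam F = morrey_norm \<Omega> p' lam F"
  unfolding morrey_norm_def by (subst morrey_modular_cong[OF assms]) simp_all

lemma ennreal_powr_minus_mult_le_1_iff:
  assumes "0 < r"
  shows "ennreal (r powr - l) * X \<le> 1 \<longleftrightarrow> X \<le> ennreal (r powr l)"
proof
  assume "ennreal (r powr - l) * X \<le> 1"
  then have "ennreal (r powr l) * (ennreal (r powr - l) * X) \<le> ennreal (r powr l) * 1"
    by (intro mult_left_mono) auto
  moreover have "ennreal (r powr l) * ennreal (r powr - l) = 1"
    using assms by (simp add: ennreal_mult[symmetric] powr_add[symmetric])
  ultimately show "X \<le> ennreal (r powr l)" by (simp add: mult.assoc[symmetric])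
next
  assume "X \<le> ennreal (r powr l)"
  then have "ennreal (r powr - l) * X \<le> ennreal (r powr - l) * ennreal (r powr l)"
    by (intro mult_left_mono) auto
  also have "\<dots> = 1" using assms by (simp add: ennreal_mult[symmetric] powr_add[symmetric])
  finally show "ennreal (r powr - l) * X \<le> 1" .
qed

text \<open>Completing the measure does not change these integrals, so \<open>lebesgue\<close>
  becomes \<open>lborel\<close>; multiplying by \<open>r powr lam x\<close> clears the negative
  power.\<close>

lemma morrey_modular_le_1_iff:
  "morrey_modular \<Omega> p lam F \<le> 1 \<longleftrightarrow>
    (\<forall>x\<in>\<Omega>. \<forall>r>0. (\<integral>\<^sup>+y\<in>{y \<in> \<Omega>. dist x y < r}. ennreal (norm (F y) powr p y) \<partial>lborel) \<le> ennreal (r powr lam x))"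
  unfolding morrey_modular_def nn_integral_completion
  by (auto simp: SUP_le_iff ennreal_powr_minus_mult_le_1_iff)

text \<open>If \<eta> is admissible on the right, then \<open>C * \<eta>\<close> is admissible on
  the left: since \<open>C \<ge> 1\<close> and \<open>q > 1\<close>, division of the function by
  \<open>C\<close> shrinks the modular at least by the factor \<open>1 / C\<close>, which absorbs
  \<open>CT\<close>. This is the reason for \<open>max 1 CT\<close>.\<close>

lemma (in morrey_data) morrey_norm_le:
  assumes "open \<Omega>" and f: "f \<in> C1_compact_support \<Omega>"
  shows "morrey_norm \<Omega> q lam (\<lambda>x. norm x powr a * f x)
    \<le> ennreal (max 1 CT) * morrey_norm \<Omega> p lam (\<lambda>x. norm x powr b *\<^sub>R gradient f x)"
proof -
  let ?w = "\<lambda>x. norm x powr a * f x" and ?d = "\<lambda>x. norm x powr b *\<^sub>R gradient f x"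
  define C where "C = max 1 CT"
  have C: "1 \<le> C" "CT \<le> C" by (simp_all add: C_def)
  have scaled: "morrey_norm \<Omega> q lam ?w \<le> ennreal C * ennreal \<eta>"
    if \<eta>: "0 < \<eta>" and mod: "morrey_modular \<Omega> p lam (\<lambda>x. ?d x /\<^sub>R \<eta>) \<le> 1" for \<eta>
  proof -
    define f0 where "f0 x = (if x \<in> \<Omega> then f x else 0)" for x
    define g0 where "g0 x = (if x \<in> \<Omega> then gradient f x else 0)" for x
    define fe where "fe x = f0 x / \<eta>" for x
    define ge where "ge x = g0 x /\<^sub>R \<eta>" for x
    have g0: "GDERIV f0 x :> g0 x" "continuous_on UNIV g0" for x
      using C1_compact_support_extend[OF f \<open>open \<Omega>\<close>] by (simp_all add: f0_def[abs_def] g0_def[abs_def])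
    have fe: "C1_in fe ge"
      unfolding C1_in_def
    proof (intro conjI allI impI)
      show "GDERIV fe z :> ge z" for z
        using has_derivative_mult_right[OF g0(1)[of z, unfolded gderiv_def], of "inverse \<eta>"]
        by (simp add: gderiv_def fe_def[abs_def] ge_def divide_inverse mult.commute)
      show "continuous_on UNIV ge"
        unfolding ge_def[abs_def] using g0(2) by (intro continuous_intros)
    qed (auto simp: fe_def ge_def f0_def g0_def)
    have ge_borel[measurable]: "ge \<in> borel_measurable borel"
      using fe by (intro borel_measurable_continuous_onI) (simp add: C1_in_def)
    have G: "morrey_unit (\<lambda>y. norm y powr b * norm (ge y))"
      unfolding morrey_unit_def
    proof (intro conjI ballI allI impI)
      show "(\<lambda>y. norm y powr b * norm (ge y)) \<in> borel_measurable borel" by measurable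
      fix x r assume x: "x \<in> \<Omega>" and r: "(0::real) < r"
      have "(\<integral>\<^sup>+y\<in>ball x r. ennreal ((norm y powr b * norm (ge y)) powr p y) \<partial>lborel)
        = (\<integral>\<^sup>+y\<in>{y \<in> \<Omega>. dist x y < r}. ennreal (norm (?d y /\<^sub>R \<eta>) powr p y) \<partial>lborel)"
      proof (intro nn_integral_cong)
        fix y
        have "norm y powr b * norm (ge y) = norm (?d y /\<^sub>R \<eta>)" if "y \<in> \<Omega>"
          using that \<eta> by (simp add: ge_def g0_def abs_mult mult_ac)
        moreover have "ge y = 0" if "y \<notin> \<Omega>" using that by (simp add: ge_def g0_def)
        ultimately show "ennreal ((norm y powr b * norm (ge y)) powr p y) * indicator (ball x r) y
          = ennreal (norm (?d y /\<^sub>R \<eta>) powr p y) * indicator {y \<in> \<Omega>. dist x y < r} y"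
          by (cases "y \<in> \<Omega>") (simp_all add: indicator_def)
      qed
      also have "\<dots> \<le> ennreal (r powr lam x)"
        using mod x r unfolding morrey_modular_le_1_iff by blast
      finally show "(\<integral>\<^sup>+y\<in>ball x r. ennreal ((norm y powr b * norm (ge y)) powr p y) \<partial>lborel) \<le> ennreal (r powr lam x)" .
    qed (auto simp: ge_def g0_def)
    have fe_borel: "fe \<in> borel_measurable borel"
    proof -
      have "continuous_on UNIV fe"
        using fe unfolding C1_in_def gderiv_def
        by (auto intro!: has_derivative_continuous_on[of UNIV fe "\<lambda>z h. h \<bullet> ge z"])
      then show ?thesis by (rule borel_measurable_continuous_onI)
    qed
    have "morrey_modular \<Omega> q lam (\<lambda>x. ?w x /\<^sub>R (C * \<eta>)) \<le> 1"
      unfolding morrey_modular_le_1_iff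
    proof (intro ballI allI impI)
      fix x r assume x: "x \<in> \<Omega>" and r: "(0::real) < r"
      have "(\<integral>\<^sup>+y\<in>{y \<in> \<Omega>. dist x y < r}. ennreal (norm (?w y /\<^sub>R (C * \<eta>)) powr q y) \<partial>lborel)
        \<le> (\<integral>\<^sup>+y. ennreal (1 / C) * (ennreal ((norm y powr a * \<bar>fe y\<bar>) powr q y) * indicator (ball x r) y) \<partial>lborel)"
      proof (rule nn_integral_mono)
        fix y
        show "ennreal (norm (?w y /\<^sub>R (C * \<eta>)) powr q y) * indicator {y \<in> \<Omega>. dist x y < r} y
          \<le> ennreal (1 / C) * (ennreal ((norm y powr a * \<bar>fe y\<bar>) powr q y) * indicator (ball x r) y)"
        proof (cases "y \<in> \<Omega> \<and> dist x y < r")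
          case True
          have "norm (?w y /\<^sub>R (C * \<eta>)) = (1 / C) * (norm y powr a * \<bar>fe y\<bar>)"
            using True C \<eta> by (simp add: fe_def f0_def abs_mult divide_inverse mult_ac)
          then have "norm (?w y /\<^sub>R (C * \<eta>)) powr q y = (1 / C) powr q y * (norm y powr a * \<bar>fe y\<bar>) powr q y"
            using C by (simp only: powr_mult)
          also have "\<dots> \<le> (1 / C) powr 1 * (norm y powr a * \<bar>fe y\<bar>) powr q y"
            using C q_gt[of y] by (intro mult_right_mono powr_mono') auto
          finally have "norm (?w y /\<^sub>R (C * \<eta>)) powr q y \<le> (1 / C) * (norm y powr a * \<bar>fe y\<bar>) powr q y"
            using C by simp
          then have "ennreal (norm (?w y /\<^sub>R (C * \<eta>)) powr q y) \<le> ennreal ((1 / C) * (norm y powr a * \<bar>fe y\<bar>) powr q y)"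
            by (rule ennreal_leI)
          also have "\<dots> = ennreal (1 / C) * ennreal ((norm y powr a * \<bar>fe y\<bar>) powr q y)"
            using C by (intro ennreal_mult) auto
          finally show ?thesis using True by (simp add: indicator_def)
        qed (auto simp: indicator_def)
      qed
      also have "\<dots> = ennreal (1 / C) * (\<integral>\<^sup>+y\<in>ball x r. ennreal ((norm y powr a * \<bar>fe y\<bar>) powr q y) \<partial>lborel)"
        using fe_borel by (intro nn_integral_cmult borel_measurable_times_ennreal borel_measurable_indicator) auto
      also have "\<dots> \<le> ennreal (1 / C) * ennreal (CT * r powr lam x)"
        by (intro mult_left_mono morrey_estimate[OF fe G x r]) auto
      also have "\<dots> = ennreal (1 / C * (CT * r powr lam x))"
        using C CT_pos by (intro ennreal_mult[symmetric]) auto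
      also have "\<dots> \<le> ennreal (r powr lam x)"
      proof (rule ennreal_leI)
        have "1 / C * (CT * r powr lam x) = CT / C * r powr lam x" by simp
        also have "\<dots> \<le> 1 * r powr lam x" using C CT_pos by (intro mult_right_mono) auto
        finally show "1 / C * (CT * r powr lam x) \<le> r powr lam x" by simp
      qed
      finally show "(\<integral>\<^sup>+y\<in>{y \<in> \<Omega>. dist x y < r}. ennreal (norm (?w y /\<^sub>R (C * \<eta>)) powr q y) \<partial>lborel) \<le> ennreal (r powr lam x)" .
    qed
    then have "morrey_norm \<Omega> q lam ?w \<le> ennreal (C * \<eta>)"
      unfolding morrey_norm_def using C \<eta> by (intro Inf_lower) auto
    then show ?thesis using C \<eta> by (simp add: ennreal_mult)
  qed
  \<comment> \<open>With the constant moved to the left, the infimum can be tested on each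
    admissible \<eta>; if there is none, the right-hand side is infinite.\<close>
  have "morrey_norm \<Omega> q lam ?w / ennreal C \<le> morrey_norm \<Omega> p lam ?d"
    unfolding morrey_norm_def[of \<Omega> p]
  proof (rule Inf_greatest)
    fix e assume "e \<in> {ennreal \<eta> |\<eta>. 0 < \<eta> \<and> morrey_modular \<Omega> p lam (\<lambda>x. ?d x /\<^sub>R \<eta>) \<le> 1}"
    then obtain \<eta> where "e = ennreal \<eta>" "0 < \<eta>" "morrey_modular \<Omega> p lam (\<lambda>x. ?d x /\<^sub>R \<eta>) \<le> 1" by blast
    then show "morrey_norm \<Omega> q lam ?w / ennreal C \<le> e"
      using scaled[of \<eta>] C by (intro divide_le_posI_ennreal) auto
  qed
  then have "ennreal C * (morrey_norm \<Omega> q lam ?w / ennreal C) \<le> ennreal C * morrey_norm \<Omega> p lam ?d"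
    by (rule mult_left_mono) simp
  moreover have "ennreal C * (morrey_norm \<Omega> q lam ?w / ennreal C) = morrey_norm \<Omega> q lam ?w"
    using C by (simp add: ennreal_times_divide ennreal_mult_divide_eq mult.commute[of "ennreal C"])
  ultimately show ?thesis by (simp add: C_def)
qed

theorem theorem4p2:
  fixes \<Omega> :: "'a::euclidean_space set"
    and p q lam :: "'a \<Rightarrow> real"
    and a b :: real
  assumes "bounded \<Omega>" and "open \<Omega>" and "0 \<in> \<Omega>"
    and "(\<lambda>x. ereal (p x)) \<in> variable_exponents \<Omega>"
    and "(\<lambda>x. ereal (q x)) \<in> variable_exponents \<Omega>"
    and "p \<in> LH0 \<Omega>" and "q \<in> LH0 \<Omega>"
    and "1 < ess_inf_on \<Omega> p" and "ess_inf_on \<Omega> p \<le> ess_sup_on \<Omega> p" and "ess_sup_on \<Omega> p < \<infinity>"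
    and "1 < ess_inf_on \<Omega> q" and "ess_inf_on \<Omega> q \<le> ess_sup_on \<Omega> q" and "ess_sup_on \<Omega> q < \<infinity>"
    and "\<forall>x\<in>\<Omega>. p x \<le> q x"
    and "lam \<in> borel_measurable (lebesgue_on \<Omega>)"
    and "\<forall>x\<in>\<Omega>. 0 \<le> lam x \<and> lam x \<le> real DIM('a)"
    and "0 < ess_inf_on \<Omega> lam" and "ess_inf_on \<Omega> lam \<le> ess_sup_on \<Omega> lam"
    and "ess_sup_on \<Omega> lam < ereal (real DIM('a))"
    and "lam \<in> LH0 \<Omega>"
    and "0 \<le> b - a" and "b - a \<le> 1"
    and "(ess_sup_on \<Omega> lam - ereal (real DIM('a))) / ess_sup_on \<Omega> q < ereal a"
    and "a \<le> b"
    and "ereal b < ereal (real DIM('a)) / ess_sup_on \<Omega> (conjugate_exponent p)"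
    and "\<forall>x\<in>\<Omega>. ess_inf_on \<Omega> lam \<le> ereal (lam x) \<and>
           lam x < real DIM('a) - (1 - b + a) * p x"
    and "\<forall>x\<in>\<Omega>. (1 + a - b) / (real DIM('a) - lam x) = 1 / p x - 1 / q x"
  shows "\<exists>C::real. C > 0 \<and>
    (\<forall>f \<in> C1_compact_support \<Omega>.
       morrey_norm \<Omega> q lam (\<lambda>x. norm x powr a * f x)
         \<le> ennreal C * morrey_norm \<Omega> p lam (\<lambda>x. norm x powr b *\<^sub>R gradient f x))"
proof -
  let ?n = "real DIM('a)"
  note AE_le = AE_le_imp_le_continuous_on[OF \<open>open \<Omega>\<close>]
  have cont: "continuous_on \<Omega> p" "continuous_on \<Omega> q" "continuous_on \<Omega> lam"
    using assms LH0_continuous_on by blast+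
  obtain \<sigma> where \<sigma>: "ess_inf_on \<Omega> p = ereal \<sigma>" "1 < \<sigma>"
    using \<open>1 < ess_inf_on \<Omega> p\<close> \<open>ess_inf_on \<Omega> p \<le> ess_sup_on \<Omega> p\<close> \<open>ess_sup_on \<Omega> p < \<infinity>\<close>
    by (cases "ess_inf_on \<Omega> p") auto
  obtain Q where Q: "ess_sup_on \<Omega> q = ereal Q"
    using \<open>1 < ess_inf_on \<Omega> q\<close> \<open>ess_inf_on \<Omega> q \<le> ess_sup_on \<Omega> q\<close> \<open>ess_sup_on \<Omega> q < \<infinity>\<close>
    by (cases "ess_sup_on \<Omega> q") auto
  obtain \<Lambda> where \<Lambda>: "ess_sup_on \<Omega> lam = ereal \<Lambda>" "\<Lambda> < ?n"
    using \<open>0 < ess_inf_on \<Omega> lam\<close> \<open>ess_inf_on \<Omega> lam \<le> ess_sup_on \<Omega> lam\<close> \<open>ess_sup_on \<Omega> lam < ereal ?n\<close>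
    by (cases "ess_sup_on \<Omega> lam") auto
  obtain l where l: "ess_inf_on \<Omega> lam = ereal l" "0 < l"
    using \<open>0 < ess_inf_on \<Omega> lam\<close> \<open>ess_inf_on \<Omega> lam \<le> ess_sup_on \<Omega> lam\<close> \<Lambda>
    by (cases "ess_inf_on \<Omega> lam") auto
  \<comment> \<open>The essential infimum is minus the essential supremum of \<open>- p\<close>, so
    the almost everywhere bound is one for \<open>- p\<close>; continuity makes it hold
    everywhere.\<close>
  have p_ge: "\<sigma> \<le> p x" if "x \<in> \<Omega>" for x
  proof -
    have "AE x in lebesgue_on \<Omega>. - ereal (p x) \<le> esssup (lebesgue_on \<Omega>) (\<lambda>x. - ereal (p x))"
      by (rule esssup_AE)
    moreover have "esssup (lebesgue_on \<Omega>) (\<lambda>x. - ereal (p x)) = ereal (- \<sigma>)"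
      using \<sigma>(1) unfolding ess_inf_on_def by (metis ereal_uminus_uminus uminus_ereal.simps(1))
    ultimately have "AE x in lebesgue_on \<Omega>. - p x \<le> - \<sigma>" by simp
    then have "- p x \<le> - \<sigma>" using that cont(1) by (intro AE_le) (auto intro: continuous_intros)
    then show ?thesis by simp
  qed
  have q_le: "q x \<le> Q" if "x \<in> \<Omega>" for x
  proof -
    have "AE x in lebesgue_on \<Omega>. ereal (q x) \<le> ereal Q"
      using esssup_AE[of "\<lambda>x. ereal (q x)" "lebesgue_on \<Omega>"] Q unfolding ess_sup_on_def by simp
    then show ?thesis using that cont(2) by (intro AE_le) auto
  qed
  have lam_le: "lam x \<le> \<Lambda>" if "x \<in> \<Omega>" for x
  proof -
    have "AE x in lebesgue_on \<Omega>. ereal (lam x) \<le> ereal \<Lambda>"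
      using esssup_AE[of "\<lambda>x. ereal (lam x)" "lebesgue_on \<Omega>"] \<Lambda> unfolding ess_sup_on_def by simp
    then show ?thesis using that cont(3) by (intro AE_le) auto
  qed
  have lam_ge: "l \<le> lam x" if "x \<in> \<Omega>" for x
    using assms that l by auto
  have p_le_q: "p x \<le> q x" if "x \<in> \<Omega>" for x using assms that by blast
  \<comment> \<open>The supremum of the conjugate exponent dominates its value at almost every
    \<open>x\<close>, and dividing \<open>n\<close> by that value gives
    \<open>n - n / p x\<close>.\<close>
  have b_le: "b \<le> ?n - ?n / p x" if "x \<in> \<Omega>" for x
  proof -
    have "AE x in lebesgue_on \<Omega>. conjugate_exponent p x \<le> ess_sup_on \<Omega> (conjugate_exponent p)"
      unfolding ess_sup_on_def by (rule esssup_AE)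
    moreover have "AE x in lebesgue_on \<Omega>. x \<in> \<Omega>" by (rule AE_I2) simp
    ultimately have "AE x in lebesgue_on \<Omega>. ?n / p x \<le> ?n - b"
    proof eventually_elim
      case (elim x)
      have px: "1 < p x" using p_ge[OF elim(2)] \<sigma> by simp
      define c where "c = 1 / (1 - 1 / p x)"
      have c: "0 < c" using px by (simp add: c_def)
      have "conjugate_exponent p x = ereal c"
        using px by (simp add: conjugate_exponent_def c_def one_ereal_def)
      then have le: "ereal c \<le> ess_sup_on \<Omega> (conjugate_exponent p)" using elim(1) by simp
      have "?n / c = ?n - ?n / p x" using px by (simp add: c_def algebra_simps)
      moreover have "b \<le> ?n / c"
      proof (cases "ess_sup_on \<Omega> (conjugate_exponent p)")
        case (real s)
        then have s: "c \<le> s" using le by simp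
        have "b < ?n / s"
          using \<open>ereal b < ereal ?n / ess_sup_on \<Omega> (conjugate_exponent p)\<close> real s c by simp
        also have "\<dots> \<le> ?n / c" using s c by (intro divide_left_mono mult_pos_pos) auto
        finally show ?thesis by simp
      next
        \<comment> \<open>Division by infinity is 0 in \<open>ereal\<close>, so the hypothesis reads
          \<open>b < 0\<close>.\<close>
        case PInf
        then have "b < 0"
          using \<open>ereal b < ereal ?n / ess_sup_on \<Omega> (conjugate_exponent p)\<close> by simp
        also have "0 \<le> ?n / c" using c by simp
        finally show ?thesis by simp
      qed (use le in auto)
      ultimately show ?case by simp
    qed
    then have "?n / p x \<le> ?n - b"
      using that cont(1) p_ge \<sigma> by (intro AE_le) (force intro!: continuous_intros)+
    then show ?thesis by simp
  qed
  obtain M where M: "\<And>x. x \<in> \<Omega> \<Longrightarrow> norm x \<le> M" using \<open>bounded \<Omega>\<close> unfolding bounded_iff by blast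
  define R where "R = 2 * (\<bar>M\<bar> + 1)"
  have R: "1 \<le> R" "1 \<le> 6 * R" "x \<in> \<Omega> \<Longrightarrow> norm x < R / 2" for x
    using M[of x] by (auto simp: R_def)
  have U: "\<bar>p x\<bar> \<le> Q" "\<bar>q x\<bar> \<le> Q" "\<bar>lam x\<bar> \<le> \<Lambda>" if "x \<in> \<Omega>" for x
    using p_ge[OF that] p_le_q[OF that] q_le[OF that] lam_ge[OF that] lam_le[OF that] \<sigma> l by auto
  obtain K1 where K1: "1 \<le> K1" "\<And>x y r. x \<in> \<Omega> \<Longrightarrow> y \<in> \<Omega> \<Longrightarrow> 0 < r \<Longrightarrow> r \<le> 6 * R \<Longrightarrow> dist x y \<le> 2 * r \<Longrightarrow> r powr (p x - p y) \<le> K1"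
    using LH0_powr_le[OF \<open>p \<in> LH0 \<Omega>\<close> U(1) R(2)] by blast
  obtain K2 where K2: "\<And>x y r. x \<in> \<Omega> \<Longrightarrow> y \<in> \<Omega> \<Longrightarrow> 0 < r \<Longrightarrow> r \<le> 6 * R \<Longrightarrow> dist x y \<le> 2 * r \<Longrightarrow> r powr (q x - q y) \<le> K2"
    using LH0_powr_le[OF \<open>q \<in> LH0 \<Omega>\<close> U(2) R(2)] by blast
  obtain K3 where K3: "\<And>x y r. x \<in> \<Omega> \<Longrightarrow> y \<in> \<Omega> \<Longrightarrow> 0 < r \<Longrightarrow> r \<le> 6 * R \<Longrightarrow> dist x y \<le> 2 * r \<Longrightarrow> r powr (lam x - lam y) \<le> K3"
    using LH0_powr_le[OF \<open>lam \<in> LH0 \<Omega>\<close> U(3) R(2)] by blast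
  \<comment> \<open>Not the conjugate exponent but an extension off \<Omega>. Both exponents get the
    value \<sigma> there, which preserves \<open>\<sigma> \<le> p' x \<le> q' x \<le> Q\<close>
    everywhere.\<close>
  define p' where "p' x = (if x \<in> \<Omega> then p x else \<sigma>)" for x
  define q' where "q' x = (if x \<in> \<Omega> then q x else \<sigma>)" for x
  \<comment> \<open>The minimum of \<open>l\<close> and \<open>n - \<Lambda>\<close> bounds
    \<open>lam\<close> and \<open>n - lam\<close> from below at once.\<close>
  interpret morrey_data \<Omega> p' q' lam a b R \<sigma> Q "min l (?n - \<Lambda>)" "max K1 (max K2 K3)" ?n
  proof
    show "p' \<in> borel_measurable borel" "q' \<in> borel_measurable borel"
      unfolding p'_def[abs_def] q'_def[abs_def] using \<open>open \<Omega>\<close> cont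
      by (auto intro!: borel_measurable_continuous_on_if)
    show "\<sigma> \<le> p' x" "p' x \<le> q' x" for x
      using p_ge p_le_q by (auto simp: p'_def q'_def)
    show "q' x \<le> Q" for x
      using p_ge[OF \<open>0 \<in> \<Omega>\<close>] p_le_q[OF \<open>0 \<in> \<Omega>\<close>] q_le[OF \<open>0 \<in> \<Omega>\<close>] q_le by (auto simp: q'_def)
    show "r powr (p' x - p' y) \<le> max K1 (max K2 K3)"
      if "x \<in> \<Omega>" "y \<in> \<Omega>" "0 < r" "r \<le> 6 * R" "dist x y \<le> 2 * r" for x y r
      using K1(2)[OF that] that by (simp add: p'_def)
    show "r powr (q' x - q' y) \<le> max K1 (max K2 K3)"
      if "x \<in> \<Omega>" "y \<in> \<Omega>" "0 < r" "r \<le> 6 * R" "dist x y \<le> 2 * r" for x y r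
      using K2[OF that] that by (simp add: q'_def)
    show "r powr (lam x - lam y) \<le> max K1 (max K2 K3)"
      if "x \<in> \<Omega>" "y \<in> \<Omega>" "0 < r" "r \<le> 6 * R" "dist x y \<le> 2 * r" for x y r
      using K3[OF that] by simp
    show "(1 + a - b) / (?n - lam x) = 1 / p' x - 1 / q' x" if "x \<in> \<Omega>" for x
      using assms that by (simp add: p'_def q'_def)
    have q0: "1 < q 0" using p_ge[OF \<open>0 \<in> \<Omega>\<close>] p_le_q[OF \<open>0 \<in> \<Omega>\<close>] \<sigma> by linarith
    have "(\<Lambda> - ?n) / Q < a"
      using \<open>(ess_sup_on \<Omega> lam - ereal ?n) / ess_sup_on \<Omega> q < ereal a\<close> \<Lambda> Q q0 q_le[OF \<open>0 \<in> \<Omega>\<close>] by simp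
    moreover have "(?n - \<Lambda>) / Q \<le> (?n - lam 0) / q 0"
      using lam_le[OF \<open>0 \<in> \<Omega>\<close>] \<Lambda> q0 q_le[OF \<open>0 \<in> \<Omega>\<close>] by (intro frac_le) auto
    ultimately show "- ((?n - lam 0) / q' 0) < a"
      using \<open>0 \<in> \<Omega>\<close> by (simp add: q'_def diff_divide_distrib)
    \<comment> \<open>The pointwise bound on \<open>b\<close> is a weak inequality; strictness comes
      from \<open>lam 0 > 0\<close>.\<close>
    have "(?n - lam 0) / p 0 < ?n / p 0"
      using lam_ge[OF \<open>0 \<in> \<Omega>\<close>] l p_ge[OF \<open>0 \<in> \<Omega>\<close>] \<sigma> by (intro divide_strict_right_mono) auto
    then show "b < ?n - (?n - lam 0) / p' 0"
      using b_le[OF \<open>0 \<in> \<Omega>\<close>] \<open>0 \<in> \<Omega>\<close> by (simp add: p'_def)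
    show "min l (?n - \<Lambda>) \<le> lam x" if "x \<in> \<Omega>" for x using lam_ge[OF that] by simp
    show "lam x \<le> ?n - min l (?n - \<Lambda>)" if "x \<in> \<Omega>" for x using lam_le[OF that] by simp
  qed (use assms \<sigma> R l \<Lambda> K1 in auto)
  have norms: "morrey_norm \<Omega> q' lam F = morrey_norm \<Omega> q lam F" "morrey_norm \<Omega> p' lam F' = morrey_norm \<Omega> p lam F'"
    for F :: "'a \<Rightarrow> real" and F' :: "'a \<Rightarrow> 'a"
    by (rule morrey_norm_cong; simp add: p'_def q'_def)+
  show ?thesis
    using morrey_norm_le[OF \<open>open \<Omega>\<close>] unfolding norms
    by (intro exI[of _ "max 1 CT"]) auto
qed

end
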